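(* All reducts of the random graph are model-complete.
   Context: The random graph $G=(V;E)$ is the countably infinite (undirected, loopless) graph, unique up to isomorphism, such that for all finite disjoint $U,U'\subseteq V$ there is $v\in V\setminus(U\cup U')$ adjacent to all vertices in $U$ and to none in $U'$. A reduct of $G$ is a relational structure with domain $V$ all of whose relations are first-order definable (without parameters) in $G$. A first-order theory $T$ is model-complete iff every embedding between models of $T$ is elementary, i.e. preserves all first-order formulas. A structure is model-complete iff its first-order theory is model-complete. *)

theory Defs
  imports "HOL-Library.Countable_Set" "HOL-Library.FuncSet"
begin

text \<open>
  A relational signature is a partial map from symbols to arities; its domain is the set of
  relation symbols. It may be empty or of any cardinality.
\<close>

type_synonym 's signature = "'s \<rightharpoonup> nat"

datatype 's form =
    Equal nat nat
  | Rel 's "nat list"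
  | Neg "'s form"
  | Conj "'s form" "'s form"
  | Exists nat "'s form"

primrec free_vars :: "'s form \<Rightarrow> nat set" where
  "free_vars (Equal x y) = {x, y}"
| "free_vars (Rel r xs) = set xs"
| "free_vars (Neg \<phi>) = free_vars \<phi>"
| "free_vars (Conj \<phi> \<psi>) = free_vars \<phi> \<union> free_vars \<psi>"
| "free_vars (Exists x \<phi>) = free_vars \<phi> - {x}"

primrec wf_form :: "'s signature \<Rightarrow> 's form \<Rightarrow> bool" where
  "wf_form \<Sigma> (Equal x y) \<longleftrightarrow> True"
| "wf_form \<Sigma> (Rel r xs) \<longleftrightarrow> \<Sigma> r = Some (length xs)"
| "wf_form \<Sigma> (Neg \<phi>) \<longleftrightarrow> wf_form \<Sigma> \<phi>"
| "wf_form \<Sigma> (Conj \<phi> \<psi>) \<longleftrightarrow> wf_form \<Sigma> \<phi> \<and> wf_form \<Sigma> \<psi>"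
| "wf_form \<Sigma> (Exists x \<phi>) \<longleftrightarrow> wf_form \<Sigma> \<phi>"

definition sentences :: "'s signature \<Rightarrow> 's form set" where
  "sentences \<Sigma> = {\<phi>. wf_form \<Sigma> \<phi> \<and> free_vars \<phi> = {}}"

record ('s, 'a) rel_structure =
  carrier :: "'a set"
  interp :: "'s \<Rightarrow> 'a list set"

definition tuples :: "nat \<Rightarrow> 'a set \<Rightarrow> 'a list set" where
  "tuples n A = {xs. length xs = n \<and> set xs \<subseteq> A}"

text \<open>
  The value of \<^const>\<open>interp\<close> at symbols outside the signature is unconstrained; no
  well-formed formula refers to it.
\<close>

definition is_structure :: "'s signature \<Rightarrow> ('s, 'a) rel_structure \<Rightarrow> bool" where
  "is_structure \<Sigma> M \<longleftrightarrow>
     carrier M \<noteq> {} \<and> (\<forall>r n. \<Sigma> r = Some n \<longrightarrow> interp M r \<subseteq> tuples n (carrier M))"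

primrec sat :: "('s, 'a) rel_structure \<Rightarrow> (nat \<Rightarrow> 'a) \<Rightarrow> 's form \<Rightarrow> bool" where
  "sat M e (Equal x y) \<longleftrightarrow> e x = e y"
| "sat M e (Rel r xs) \<longleftrightarrow> map e xs \<in> interp M r"
| "sat M e (Neg \<phi>) \<longleftrightarrow> \<not> sat M e \<phi>"
| "sat M e (Conj \<phi> \<psi>) \<longleftrightarrow> sat M e \<phi> \<and> sat M e \<psi>"
| "sat M e (Exists x \<phi>) \<longleftrightarrow> (\<exists>a\<in>carrier M. sat M (e(x := a)) \<phi>)"

definition valid_in :: "('s, 'a) rel_structure \<Rightarrow> 's form \<Rightarrow> bool" where
  "valid_in M \<phi> \<longleftrightarrow> (\<forall>e \<in> UNIV \<rightarrow> carrier M. sat M e \<phi>)"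

definition is_model :: "'s signature \<Rightarrow> 's form set \<Rightarrow> ('s, 'a) rel_structure \<Rightarrow> bool" where
  "is_model \<Sigma> T M \<longleftrightarrow> is_structure \<Sigma> M \<and> (\<forall>\<phi>\<in>T. valid_in M \<phi>)"

definition theory_of :: "'s signature \<Rightarrow> ('s, 'a) rel_structure \<Rightarrow> 's form set" where
  "theory_of \<Sigma> M = {\<phi> \<in> sentences \<Sigma>. valid_in M \<phi>}"

definition embedding ::
  "'s signature \<Rightarrow> ('s, 'a) rel_structure \<Rightarrow> ('s, 'b) rel_structure \<Rightarrow> ('a \<Rightarrow> 'b) \<Rightarrow> bool" where
  "embedding \<Sigma> M N h \<longleftrightarrow>
     h \<in> carrier M \<rightarrow> carrier N \<and> inj_on h (carrier M) \<and>
     (\<forall>r n. \<Sigma> r = Some n \<longrightarrow>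
        (\<forall>xs \<in> tuples n (carrier M). xs \<in> interp M r \<longleftrightarrow> map h xs \<in> interp N r))"

definition elementary ::
  "'s signature \<Rightarrow> ('s, 'a) rel_structure \<Rightarrow> ('s, 'b) rel_structure \<Rightarrow> ('a \<Rightarrow> 'b) \<Rightarrow> bool" where
  "elementary \<Sigma> M N h \<longleftrightarrow>
     (\<forall>\<phi>. wf_form \<Sigma> \<phi> \<longrightarrow>
        (\<forall>e \<in> UNIV \<rightarrow> carrier M. sat M e \<phi> \<longrightarrow> sat N (h \<circ> e) \<phi>))"

text \<open>
  HOL cannot quantify over types inside a formula, so the types from which the elements of the
  two models are drawn are parameters. Model-completeness is the assertion of this predicate
  for all types \<open>'m\<close> and \<open>'n\<close>, that is, with both left as type variables in a theorem.
\<close>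

definition model_complete_theory ::
  "'m itself \<Rightarrow> 'n itself \<Rightarrow> 's signature \<Rightarrow> 's form set \<Rightarrow> bool" where
  "model_complete_theory _ _ \<Sigma> T \<longleftrightarrow>
     (\<forall>(M :: ('s, 'm) rel_structure) (N :: ('s, 'n) rel_structure) h.
        is_model \<Sigma> T M \<and> is_model \<Sigma> T N \<and> embedding \<Sigma> M N h \<longrightarrow> elementary \<Sigma> M N h)"

definition model_complete ::
  "'m itself \<Rightarrow> 'n itself \<Rightarrow> 's signature \<Rightarrow> ('s, 'a) rel_structure \<Rightarrow> bool" where
  "model_complete m n \<Sigma> A \<longleftrightarrow> model_complete_theory m n \<Sigma> (theory_of \<Sigma> A)"

text \<open>
  The formula defines the \<open>n\<close>-ary relation \<open>R\<close> through its free variables \<open>0, \<dots>, n - 1\<close>;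
  the remaining values of the assignment \<open>e\<close> are irrelevant.
\<close>

definition fo_definable ::
  "'s signature \<Rightarrow> ('s, 'a) rel_structure \<Rightarrow> nat \<Rightarrow> 'a list set \<Rightarrow> bool" where
  "fo_definable \<Sigma> M n R \<longleftrightarrow>
     R \<subseteq> tuples n (carrier M) \<and>
     (\<exists>\<phi>. wf_form \<Sigma> \<phi> \<and> free_vars \<phi> \<subseteq> {..<n} \<and>
        (\<forall>e \<in> UNIV \<rightarrow> carrier M. map e [0..<n] \<in> R \<longleftrightarrow> sat M e \<phi>))"

definition is_reduct ::
  "'s signature \<Rightarrow> ('s, 'a) rel_structure \<Rightarrow> 't signature \<Rightarrow> ('t, 'a) rel_structure \<Rightarrow> bool" where
  "is_reduct \<Sigma> A \<Gamma> B \<longleftrightarrow>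
     is_structure \<Sigma> A \<and> carrier A = carrier B \<and>
     (\<forall>r n. \<Sigma> r = Some n \<longrightarrow> fo_definable \<Gamma> B n (interp A r))"

definition random_graph :: "'v set \<Rightarrow> ('v \<times> 'v) set \<Rightarrow> bool" where
  "random_graph V E \<longleftrightarrow>
     countable V \<and> infinite V \<and> E \<subseteq> V \<times> V \<and> sym E \<and> irrefl E \<and>
     (\<forall>U U'. finite U \<and> finite U' \<and> U \<subseteq> V \<and> U' \<subseteq> V \<and> U \<inter> U' = {} \<longrightarrow>
        (\<exists>v \<in> V - (U \<union> U'). (\<forall>u\<in>U. (v, u) \<in> E) \<and> (\<forall>u\<in>U'. (v, u) \<notin> E)))"

definition graph_signature :: "unit signature" where
  "graph_signature = (\<lambda>_. Some 2)"

definition graph_structure :: "'v set \<Rightarrow> ('v \<times> 'v) set \<Rightarrow> (unit, 'v) rel_structure" where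
  "graph_structure V E = \<lparr>carrier = V, interp = (\<lambda>_. {[x, y] | x y. (x, y) \<in> E})\<rparr>"

end

theory Submission
  imports Defs "HOL-Library.Ramsey"
begin

text \<open>
  An embedding preserves existential formulas, so it suffices to find, for each formula, an
  existential formula equivalent to it in the reduct \<open>A\<close>; the equivalence is then a sentence of
  the theory of \<open>A\<close> and holds in all its models (\<open>equivalent_existential_formula\<close>). In the random
  graph the \<open>n\<close>-tuples fall into finitely many types, and the relations of \<open>A\<close> respect these
  types. Hence, by a compactness argument, if all existential formulas true of a tuple are true of
  another one, some embedding of \<open>A\<close> into itself maps the first tuple to the second
  (\<open>self_embedding_extending\<close>). So everything rests on one fact: self-embeddings \<open>f\<close> of \<open>A\<close>
  preserve all formulas.

  This is proved without the list of the five reducts. Graphs are written as predicates on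
  two-element sets of indices and compared by exclusive or. Call \<open>d\<close> a symmetry if no relation
  of \<open>A\<close> distinguishes a finite graph \<open>g\<close> from \<open>g\<close> xor \<open>d\<close>. The symmetries form a group,
  and by the extension property two tuples whose induced graphs differ by a symmetry can be
  extended, point by point, to longer tuples whose graphs still differ by that symmetry. This is a
  back-and-forth system, so such tuples satisfy the same formulas of \<open>A\<close> (\<open>sat_symmetry\<close>). It
  remains to see that \<open>f\<close> changes the graph on a finite set \<open>C\<close> only by a symmetry
  (\<open>self_embedding_twist\<close>).

  If flipping a single edge is a symmetry, everything is, and nothing has to be shown. Otherwise,
  a Ramsey argument (\<open>canonical_behaviour\<close>) finds copies of all finite graphs over \<open>C\<close> on which
  the action of \<open>f\<close> depends only on edges and on types over \<open>C\<close>. Since \<open>A\<close> cannot distinguish a graph from its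
  image under \<open>f\<close>, two graphs with the same image are indistinguishable. Each irregularity of the
  action of \<open>f\<close> makes two graphs that differ in one edge have images that agree up to a symmetry,
  which is excluded. What is left is the following: on vertices outside \<open>C\<close>, \<open>f\<close> acts as a
  switching with respect to some types, possibly followed by complementation; on \<open>C\<close>, it acts as
  a switching with respect to some points, possibly followed by complementation; and each of the
  operations that occur is a symmetry.
\<close>

section \<open>Finite Ramsey theorems\<close>

lemma ramsey_finite_colours:
  fixes K :: "'k set"
  assumes "finite K"
  shows "\<exists>M::nat. \<forall>\<kappa>. \<kappa> \<in> [{..<M}]\<^bsup>r\<^esup> \<rightarrow> K \<longrightarrow>
    (\<exists>Z\<in>[{..<M}]\<^bsup>q\<^esup>. \<exists>k. \<forall>X\<in>[Z]\<^bsup>r\<^esup>. \<kappa> X = k)"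
proof -
  obtain M :: nat where M: "partn_lst {..<M} (replicate (card K) q) r"
    using ramsey_full by blast
  obtain c where c: "bij_betw c K {..<card K}"
    using assms by (metis bij_betw_from_nat_into_finite bij_betw_inv)
  have "\<exists>Z\<in>[{..<M}]\<^bsup>q\<^esup>. \<exists>k. \<forall>X\<in>[Z]\<^bsup>r\<^esup>. \<kappa> X = k" if \<kappa>: "\<kappa> \<in> [{..<M}]\<^bsup>r\<^esup> \<rightarrow> K" for \<kappa> :: "nat set \<Rightarrow> 'k"
  proof -
    have "c \<circ> \<kappa> \<in> [{..<M}]\<^bsup>r\<^esup> \<rightarrow> {..<card K}"
      using \<kappa> c by (fastforce simp: bij_betw_def)
    from partn_lstE[OF M this] obtain i Z where Z: "i < card K" "Z \<in> [{..<M}]\<^bsup>q\<^esup>"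
      "(c \<circ> \<kappa>) ` [Z]\<^bsup>r\<^esup> \<subseteq> {i}"
      by (metis length_replicate nth_replicate)
    have "\<kappa> X = the_inv_into K c i" if "X \<in> [Z]\<^bsup>r\<^esup>" for X
    proof -
      have "X \<in> [{..<M}]\<^bsup>r\<^esup>"
        using that Z(2) by (auto simp: nsets_def)
      then have "\<kappa> X \<in> K" using \<kappa> by auto
      moreover have "c (\<kappa> X) = i" using Z(3) that by auto
      ultimately show ?thesis
        using c by (metis bij_betw_def the_inv_into_f_f)
    qed
    then show ?thesis using Z(2) by blast
  qed
  then show ?thesis by blast
qed

lemma nth_sorted_list_of_set_card_less:
  fixes X :: "nat set"
  assumes "finite X" "y \<in> X"
  shows "sorted_list_of_set X ! card {x\<in>X. x < y} = y"
proof -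
  let ?xs = "sorted_list_of_set X"
  obtain k where k: "k < length ?xs" "?xs ! k = y"
    using assms by (metis in_set_conv_nth set_sorted_list_of_set)
  have mono: "strict_sorted ?xs" by simp
  have "{x\<in>X. x < y} = (!) ?xs ` {..<k}"
  proof (intro equalityI subsetI)
    fix x assume "x \<in> {x\<in>X. x < y}"
    then obtain l where l: "l < length ?xs" "?xs ! l = x" "x < y"
      using assms by (metis (no_types, lifting) in_set_conv_nth mem_Collect_eq set_sorted_list_of_set)
    then have "l < k"
      using k mono by (metis not_less_iff_gr_or_eq sorted_wrt_nth_less)
    then show "x \<in> (!) ?xs ` {..<k}" using l by auto
  next
    fix x assume "x \<in> (!) ?xs ` {..<k}"
    then obtain l where l: "l < k" "x = ?xs ! l" by auto
    then have "x < y" using k mono by (metis sorted_wrt_nth_less)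
    moreover have "x \<in> X" using l k assms
      by (metis nth_mem order.strict_trans set_sorted_list_of_set)
    ultimately show "x \<in> {x\<in>X. x < y}" by simp
  qed
  moreover have "inj_on ((!) ?xs) {..<k}"
    using k by (auto simp: inj_on_def nth_eq_iff_index_eq)
  ultimately have "card {x\<in>X. x < y} = k" by (simp add: card_image)
  then show ?thesis using k by simp
qed

lemma finite_tuples:
  assumes "finite A"
  shows "finite (tuples n A)"
proof -
  have "tuples n A = {xs. set xs \<subseteq> A \<and> length xs = n}" by (auto simp: tuples_def)
  then show ?thesis using finite_lists_length_eq[OF assms] by simp
qed

definition same_order :: "nat list \<Rightarrow> nat list \<Rightarrow> bool" where
  "same_order us vs \<longleftrightarrow> length us = length vs \<and>
     (\<forall>a<length us. \<forall>b<length us. us ! a < us ! b \<longleftrightarrow> vs ! a < vs ! b)"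

text \<open>
  A list of \<open>m\<close> distinct numbers is its set of entries together with the permutation that sorts
  it. Colouring an \<open>m\<close>-set by the function that gives the colours of all its arrangements
  reduces the claim to the Ramsey theorem for \<open>m\<close>-sets.
\<close>
lemma ramsey_order_types:
  fixes K :: "'k set"
  assumes "finite K"
  shows "\<exists>M::nat. \<forall>col. (\<forall>L\<in>tuples m {..<M}. col L \<in> K) \<longrightarrow>
    (\<exists>z. strict_mono_on {..<Q} z \<and> z ` {..<Q} \<subseteq> {..<M} \<and>
      (\<forall>us\<in>tuples m {..<Q}. \<forall>vs\<in>tuples m {..<Q}.
         distinct us \<and> distinct vs \<and> same_order us vs \<longrightarrow> col (map z us) = col (map z vs)))"
proof -
  define P :: "nat list set" where "P = tuples m {..<m}"
  have finP: "finite P"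
    unfolding P_def by (rule finite_tuples) simp
  have "finite (Pow (P \<times> K))" using finP assms by simp
  from ramsey_finite_colours[OF this, of m Q] obtain M :: nat where M:
    "\<forall>\<kappa> :: nat set \<Rightarrow> (nat list \<times> 'k) set. \<kappa> \<in> [{..<M}]\<^bsup>m\<^esup> \<rightarrow> Pow (P \<times> K) \<longrightarrow>
      (\<exists>Z\<in>[{..<M}]\<^bsup>Q\<^esup>. \<exists>k. \<forall>X\<in>[Z]\<^bsup>m\<^esup>. \<kappa> X = k)" ..
  have "\<exists>z. strict_mono_on {..<Q} z \<and> z ` {..<Q} \<subseteq> {..<M} \<and>
      (\<forall>us\<in>tuples m {..<Q}. \<forall>vs\<in>tuples m {..<Q}.
         distinct us \<and> distinct vs \<and> same_order us vs \<longrightarrow> col (map z us) = col (map z vs))"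
    if col: "\<And>L. L \<in> tuples m {..<M} \<Longrightarrow> col L \<in> K" for col :: "nat list \<Rightarrow> 'k"
  proof -
    define arr where "arr X \<pi> = map ((!) (sorted_list_of_set X)) \<pi>" for X :: "nat set" and \<pi> :: "nat list"
    define \<kappa> where "\<kappa> X = (\<lambda>\<pi>. (\<pi>, col (arr X \<pi>))) ` P" for X :: "nat set"
    have "\<kappa> \<in> [{..<M}]\<^bsup>m\<^esup> \<rightarrow> Pow (P \<times> K)"
    proof
      fix X assume X: "X \<in> [{..<M}]\<^bsup>m\<^esup>"
      then have "finite X" "X \<subseteq> {..<M}" "card X = m" by (auto simp: nsets_def)
      have "arr X \<pi> \<in> tuples m {..<M}" if "\<pi> \<in> P" for \<pi>
      proof -
        have "sorted_list_of_set X ! k \<in> X" if "k < m" for k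
          using that \<open>finite X\<close> \<open>card X = m\<close>
          by (metis length_sorted_list_of_set nth_mem set_sorted_list_of_set)
        then show ?thesis
          using that \<open>X \<subseteq> {..<M}\<close> by (fastforce simp: arr_def P_def tuples_def)
      qed
      then show "\<kappa> X \<in> Pow (P \<times> K)" using col by (auto simp: \<kappa>_def)
    qed
    from M[rule_format, OF this] obtain Z k where Z: "Z \<in> [{..<M}]\<^bsup>Q\<^esup>"
      and k: "\<And>X. X \<in> [Z]\<^bsup>m\<^esup> \<Longrightarrow> \<kappa> X = k" by blast
    have Z': "finite Z" "Z \<subseteq> {..<M}" "card Z = Q" using Z by (auto simp: nsets_def)
    define z where "z = (!) (sorted_list_of_set Z)"
    have z_mono: "strict_mono_on {..<Q} z"
      unfolding z_def strict_mono_on_def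
      using Z' by (auto intro!: sorted_wrt_nth_less[of "(<)" "sorted_list_of_set Z"])
    then have z_inj: "inj_on z {..<Q}" by (rule strict_mono_on_imp_inj_on)
    have z_less: "z a < z b \<longleftrightarrow> a < b" if "a < Q" "b < Q" for a b
      using z_mono that by (meson lessThan_iff strict_mono_on_less)
    have zZ: "z ` {..<Q} \<subseteq> Z"
      unfolding z_def using Z' by (metis image_subsetI lessThan_iff length_sorted_list_of_set nth_mem set_sorted_list_of_set)
    (* the permutation that recovers a list from its sorted set of entries; it depends on the
       order type of the list only *)
    define rk where "rk us = map (\<lambda>a. card {b. b < m \<and> us ! b < us ! a}) [0..<m]" for us :: "nat list"
    have us: "col (map z us) = the_elem {c. (rk us, c) \<in> k}"
      if us: "us \<in> tuples m {..<Q}" "distinct us" for us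
    proof -
      have len: "length us = m" and setus: "set us \<subseteq> {..<Q}" using us by (auto simp: tuples_def)
      let ?X = "set (map z us)"
      have X: "?X \<in> [Z]\<^bsup>m\<^esup>"
        using us(2) setus zZ z_inj len
        by (auto simp: nsets_def card_image inj_on_subset distinct_card)
      have rkP: "rk us \<in> P"
      proof -
        have "card {b. b < m \<and> us ! b < us ! a} < m" if "a < m" for a
        proof -
          have "{b. b < m \<and> us ! b < us ! a} \<subset> {..<m}" using that by auto
          then show ?thesis using psubset_card_mono[of "{..<m}"] by simp
        qed
        then show ?thesis by (auto simp: P_def tuples_def rk_def)
      qed
      have "arr ?X (rk us) = map z us"
      proof (rule nth_equalityI)
        show "length (arr ?X (rk us)) = length (map z us)" by (simp add: arr_def rk_def len)
      next
        fix a assume "a < length (arr ?X (rk us))"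
        then have a: "a < m" by (simp add: arr_def rk_def)
        have "{x\<in>?X. x < z (us ! a)} = (\<lambda>b. z (us ! b)) ` {b. b < m \<and> us ! b < us ! a}"
        proof (intro equalityI subsetI)
          fix x assume "x \<in> {x\<in>?X. x < z (us ! a)}"
          then obtain b where b: "b < m" "x = z (us ! b)" "z (us ! b) < z (us ! a)"
            using len by (auto simp: in_set_conv_nth)
          moreover have "us ! b < us ! a"
            using b a setus len z_less[of "us ! b" "us ! a"]
            by (metis lessThan_iff nth_mem subsetD)
          ultimately show "x \<in> (\<lambda>b. z (us ! b)) ` {b. b < m \<and> us ! b < us ! a}" by blast
        next
          fix x assume "x \<in> (\<lambda>b. z (us ! b)) ` {b. b < m \<and> us ! b < us ! a}"
          then obtain b where b: "b < m" "x = z (us ! b)" "us ! b < us ! a" by blast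
          have "us ! b < Q" "us ! a < Q"
            using setus len a b by (metis lessThan_iff nth_mem subsetD)+
          then show "x \<in> {x\<in>?X. x < z (us ! a)}"
            using b z_less len by auto
        qed
        moreover have "inj_on (\<lambda>b. z (us ! b)) {b. b < m \<and> us ! b < us ! a}"
        proof (rule inj_onI)
          fix b b' assume bb: "b \<in> {b. b < m \<and> us ! b < us ! a}" "b' \<in> {b. b < m \<and> us ! b < us ! a}"
            "z (us ! b) = z (us ! b')"
          then have "us ! b \<in> {..<Q}" "us ! b' \<in> {..<Q}"
            using setus len by (auto intro: nth_mem)
          then have "us ! b = us ! b'" using z_inj bb(3) by (metis inj_onD)
          then show "b = b'" using bb us(2) len by (simp add: nth_eq_iff_index_eq)
        qed
        ultimately have "card {x\<in>?X. x < z (us ! a)} = card {b. b < m \<and> us ! b < us ! a}"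
          by (simp add: card_image)
        then have "sorted_list_of_set ?X ! card {b. b < m \<and> us ! b < us ! a} = z (us ! a)"
          using nth_sorted_list_of_set_card_less[of ?X "z (us ! a)"] a len
          by (metis List.finite_set length_map nth_map nth_mem)
        then show "arr ?X (rk us) ! a = map z us ! a"
          using a len by (simp add: arr_def rk_def)
      qed
      then have "(rk us, c) \<in> \<kappa> ?X \<longleftrightarrow> c = col (map z us)" for c
        using rkP by (auto simp: \<kappa>_def)
      then have "{c. (rk us, c) \<in> k} = {col (map z us)}" using k[OF X] by auto
      then show ?thesis by simp
    qed
    have "col (map z us) = col (map z vs)"
      if "us \<in> tuples m {..<Q}" "vs \<in> tuples m {..<Q}" "distinct us" "distinct vs" "same_order us vs" for us vs
    proof -
      have "rk us = rk vs"
        using that unfolding rk_def same_order_def tuples_def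
        by (auto intro!: arg_cong[where f=card])
      then show ?thesis using us that by metis
    qed
    then show ?thesis using z_mono zZ Z'(2) by blast
  qed
  then show ?thesis by blast
qed

section \<open>Twists of the random graph preserve formulas\<close>

lemma sat_cong:
  "(\<And>x. x \<in> free_vars \<phi> \<Longrightarrow> e x = e' x) \<Longrightarrow> sat M e \<phi> \<longleftrightarrow> sat M e' \<phi>"
proof (induction \<phi> arbitrary: e e')
  case (Rel r xs)
  then have "map e xs = map e' xs" by simp
  then show ?case by (simp only: sat.simps)
next
  case (Exists x \<phi>)
  have "sat M (e(x := v)) \<phi> \<longleftrightarrow> sat M (e'(x := v)) \<phi>" for v
    using Exists.prems by (intro Exists.IH) auto
  then show ?case by simp
next
  case (Conj \<phi> \<psi>)
  show ?case using Conj.IH[of e e'] Conj.prems by simp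
next
  case (Neg \<phi>)
  show ?case using Neg.IH[of e e'] Neg.prems by simp
qed simp

lemma finite_free_vars: "finite (free_vars \<phi>)"
  by (induction \<phi>) auto

locale random_graph_on =
  fixes V :: "'v set" and E :: "('v \<times> 'v) set"
  assumes random: "random_graph V E"
begin

lemma sym_E: "(x, y) \<in> E \<longleftrightarrow> (y, x) \<in> E"
  using random by (auto simp: random_graph_def sym_def)

lemma extension:
  assumes "finite W" "W \<subseteq> V"
  obtains v where "v \<in> V - W" "\<And>w. w \<in> W \<Longrightarrow> (v, w) \<in> E \<longleftrightarrow> P w"
proof -
  have "\<forall>U U'. finite U \<and> finite U' \<and> U \<subseteq> V \<and> U' \<subseteq> V \<and> U \<inter> U' = {} \<longrightarrow>
        (\<exists>v \<in> V - (U \<union> U'). (\<forall>u\<in>U. (v, u) \<in> E) \<and> (\<forall>u\<in>U'. (v, u) \<notin> E))"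
    using random by (simp add: random_graph_def)
  from this[rule_format, of "{w\<in>W. P w}" "{w\<in>W. \<not> P w}"] obtain v where
    "v \<in> V - ({w\<in>W. P w} \<union> {w\<in>W. \<not> P w})" "\<forall>u\<in>{w\<in>W. P w}. (v, u) \<in> E" "\<forall>u\<in>{w\<in>W. \<not> P w}. (v, u) \<notin> E"
    using assms by auto
  then show ?thesis by (intro that[of v]) auto
qed

text \<open>
  One application of the extension property per vertex: the new vertex has to respect the prescribed
  neighbourhood in \<open>C\<close> as well as the edges to the vertices already placed. The index type is
  arbitrary because the Ramsey argument realises a graph on triples.
\<close>
lemma realize_over:
  assumes "finite W" "finite C" "C \<subseteq> V" and sym: "\<And>u v. r u v \<longleftrightarrow> r v u"
  shows "\<exists>y. inj_on y W \<and> y ` W \<subseteq> V - C \<and>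
    (\<forall>u\<in>W. \<forall>v\<in>W. u \<noteq> v \<longrightarrow> ((y u, y v) \<in> E \<longleftrightarrow> r u v)) \<and>
    (\<forall>u\<in>W. \<forall>c\<in>C. (y u, c) \<in> E \<longleftrightarrow> c \<in> ty u)"
  using assms(1)
proof (induction W)
  case empty
  then show ?case by simp
next
  case (insert w W)
  then obtain y where y: "inj_on y W" "y ` W \<subseteq> V - C"
    "\<And>u v. u \<in> W \<Longrightarrow> v \<in> W \<Longrightarrow> u \<noteq> v \<Longrightarrow> (y u, y v) \<in> E \<longleftrightarrow> r u v"
    "\<And>u c. u \<in> W \<Longrightarrow> c \<in> C \<Longrightarrow> (y u, c) \<in> E \<longleftrightarrow> c \<in> ty u" by blast
  obtain v where v: "v \<in> V - (y ` W \<union> C)"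
    "\<And>x. x \<in> y ` W \<union> C \<Longrightarrow> (v, x) \<in> E \<longleftrightarrow> (if x \<in> C then x \<in> ty w else r w (the_inv_into W y x))"
    using extension[of "y ` W \<union> C" "\<lambda>x. if x \<in> C then x \<in> ty w else r w (the_inv_into W y x)"]
      insert.hyps y(2) assms by blast
  have vW: "(v, y u) \<in> E \<longleftrightarrow> r w u" if "u \<in> W" for u
    using v(2)[of "y u"] that y(1,2) by (auto simp: the_inv_into_f_f)
  let ?y = "y(w := v)"
  have "inj_on ?y (insert w W)"
    using y(1) v(1) insert.hyps by (auto simp: inj_on_def)
  moreover have "?y ` insert w W \<subseteq> V - C"
    using y(2) v(1) insert.hyps by auto
  moreover have "\<forall>u\<in>insert w W. \<forall>u'\<in>insert w W. u \<noteq> u' \<longrightarrow> ((?y u, ?y u') \<in> E \<longleftrightarrow> r u u')"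
    using y(3) vW insert.hyps sym sym_E by auto
  moreover have "\<forall>u\<in>insert w W. \<forall>c\<in>C. (?y u, c) \<in> E \<longleftrightarrow> c \<in> ty u"
    using y(4) v insert.hyps by auto
  ultimately show ?case by blast
qed

text \<open>
  An abstract graph on index set \<open>S\<close> is a predicate on sets of indices, of which only the values
  \<open>g {i, j}\<close> with \<open>i \<noteq> j\<close> in \<open>S\<close> matter. Symmetry of the edge relation is thereby automatic.
\<close>
definition realizes :: "nat set \<Rightarrow> (nat set \<Rightarrow> bool) \<Rightarrow> (nat \<Rightarrow> 'v) \<Rightarrow> bool" where
  "realizes S g x \<longleftrightarrow> inj_on x S \<and> x ` S \<subseteq> V \<and>
     (\<forall>i\<in>S. \<forall>j\<in>S. i \<noteq> j \<longrightarrow> ((x i, x j) \<in> E \<longleftrightarrow> g {i, j}))"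

lemma realizes_exists:
  assumes "finite S"
  obtains x where "realizes S g x"
proof -
  from realize_over[OF assms, of "{}" "\<lambda>i j. g {i, j}"] obtain x where
    "inj_on x S" "x ` S \<subseteq> V" "\<forall>i\<in>S. \<forall>j\<in>S. i \<noteq> j \<longrightarrow> ((x i, x j) \<in> E \<longleftrightarrow> g {i, j})"
    by (auto simp: insert_commute)
  then show ?thesis using that by (simp add: realizes_def)
qed

lemma realizes_cong:
  assumes "\<And>i j. i \<in> S \<Longrightarrow> j \<in> S \<Longrightarrow> i \<noteq> j \<Longrightarrow> g {i, j} \<longleftrightarrow> h {i, j}"
  shows "realizes S g x \<longleftrightarrow> realizes S h x"
  using assms by (auto simp: realizes_def)

definition graph_of :: "nat set \<Rightarrow> (nat \<Rightarrow> 'v) \<Rightarrow> nat set \<Rightarrow> bool" where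
  "graph_of S x e \<longleftrightarrow> (\<exists>i\<in>S. \<exists>j\<in>S. e = {i, j} \<and> (x i, x j) \<in> E)"

lemma graph_of_pair: "i \<in> S \<Longrightarrow> j \<in> S \<Longrightarrow> graph_of S x {i, j} \<longleftrightarrow> (x i, x j) \<in> E"
  using sym_E by (auto simp: graph_of_def doubleton_eq_iff)

lemma realizes_graph_of: "inj_on x S \<Longrightarrow> x ` S \<subseteq> V \<Longrightarrow> realizes S (graph_of S x) x"
  by (simp add: realizes_def graph_of_pair)

definition twist :: "(nat set \<Rightarrow> bool) \<Rightarrow> nat set \<Rightarrow> (nat \<Rightarrow> 'v) \<Rightarrow> (nat \<Rightarrow> 'v) \<Rightarrow> bool" where
  "twist d S a b \<longleftrightarrow> inj_on a S \<and> inj_on b S \<and> a ` S \<subseteq> V \<and> b ` S \<subseteq> V \<and>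
     (\<forall>i\<in>S. \<forall>j\<in>S. i \<noteq> j \<longrightarrow> ((b i, b j) \<in> E \<longleftrightarrow> ((a i, a j) \<in> E) \<noteq> d {i, j}))"

lemma twist_sym: "twist d S a b \<Longrightarrow> twist d S b a"
  by (auto simp: twist_def)

text \<open>
  This is the forth step of a back-and-forth system; the back step is the same statement for the
  tuples exchanged, as twists are symmetric. The value of \<open>d\<close> at pairs that contain the new index
  is already prescribed, and the extension property provides a vertex that complies with it.
\<close>
lemma twist_extend:
  assumes tw: "twist d S a b" and "finite S" "i \<notin> S" "v \<in> V - a ` S"
  obtains w where "w \<in> V" "twist d (insert i S) (a(i := v)) (b(i := w))"
proof -
  have b: "inj_on b S" "b ` S \<subseteq> V" using tw by (auto simp: twist_def)
  obtain w where w: "w \<in> V - b ` S"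
    "\<And>x. x \<in> b ` S \<Longrightarrow> (w, x) \<in> E \<longleftrightarrow> ((v, a (the_inv_into S b x)) \<in> E) \<noteq> d {i, the_inv_into S b x}"
    using extension[of "b ` S" "\<lambda>x. ((v, a (the_inv_into S b x)) \<in> E) \<noteq> d {i, the_inv_into S b x}"]
      b assms(2) by blast
  have w': "(w, b j) \<in> E \<longleftrightarrow> ((v, a j) \<in> E) \<noteq> d {i, j}" if "j \<in> S" for j
    using w(2)[of "b j"] that b by (auto simp: the_inv_into_f_f)
  have "twist d (insert i S) (a(i := v)) (b(i := w))"
    unfolding twist_def
  proof (intro conjI)
    show "inj_on (a(i := v)) (insert i S)" "inj_on (b(i := w)) (insert i S)"
      using tw assms(3,4) w(1) by (auto simp: twist_def inj_on_def)
    show "(a(i := v)) ` insert i S \<subseteq> V" "(b(i := w)) ` insert i S \<subseteq> V"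
      using tw assms(3,4) w(1) by (auto simp: twist_def)
    show "\<forall>k\<in>insert i S. \<forall>j\<in>insert i S. k \<noteq> j \<longrightarrow>
        (((b(i := w)) k, (b(i := w)) j) \<in> E \<longleftrightarrow> (((a(i := v)) k, (a(i := v)) j) \<in> E) \<noteq> d {k, j})"
    proof (intro ballI impI)
      fix k j assume kj: "k \<in> insert i S" "j \<in> insert i S" "k \<noteq> j"
      consider "k = i" "j \<in> S" | "j = i" "k \<in> S" | "k \<in> S" "j \<in> S" "k \<noteq> i" "j \<noteq> i" using kj by blast
      then show "((b(i := w)) k, (b(i := w)) j) \<in> E \<longleftrightarrow> (((a(i := v)) k, (a(i := v)) j) \<in> E) \<noteq> d {k, j}"
      proof cases
        case 1
        then show ?thesis using w' assms(3) by auto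
      next
        case 2
        then have "k \<noteq> i" using assms(3) by auto
        then show ?thesis using w'[OF 2(2)] 2
          by (simp add: sym_E[of "b k"] sym_E[of "a k"] insert_commute)
      next
        case 3
        then show ?thesis using tw kj by (auto simp: twist_def)
      qed
    qed
  qed
  then show ?thesis using that w(1) by blast
qed

text \<open>
  Twists by a fixed \<open>d\<close> are a back-and-forth system, so agreement on atomic formulas propagates to
  all formulas. The map \<open>k\<close> from variables to indices allows several variables to denote the same
  vertex although the tuples \<open>a\<close> and \<open>b\<close> are injective.
\<close>
lemma sat_twist:
  fixes \<Sigma> :: "'t signature" and A :: "('t, 'v) rel_structure"
  assumes carrier: "carrier A = V"
    and atoms: "\<And>S a b r is. finite S \<Longrightarrow> twist d S a b \<Longrightarrow> \<Sigma> r = Some (length is) \<Longrightarrow> set is \<subseteq> S \<Longrightarrow>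
      map a is \<in> interp A r \<longleftrightarrow> map b is \<in> interp A r"
  shows "wf_form \<Sigma> \<phi> \<Longrightarrow> finite S \<Longrightarrow> twist d S a b \<Longrightarrow> k ` free_vars \<phi> \<subseteq> S \<Longrightarrow>
    sat A (a \<circ> k) \<phi> \<longleftrightarrow> sat A (b \<circ> k) \<phi>"
proof (induction \<phi> arbitrary: S a b k)
  case (Equal x y)
  then show ?case by (auto simp: twist_def inj_on_eq_iff)
next
  case (Rel r xs)
  then show ?case using atoms[of S a b r "map k xs"] by (simp add: comp_def)
next
  case (Exists x \<phi>)
  have dir: "sat A (b \<circ> k) (Exists x \<phi>)"
    if tw: "twist d S a b" and sat: "sat A (a \<circ> k) (Exists x \<phi>)" for a b
  proof -
    obtain v where v: "v \<in> V" "sat A ((a \<circ> k)(x := v)) \<phi>" using sat carrier by auto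
    obtain i T a' b' where i: "i \<in> T" "finite T" "S \<subseteq> T" "twist d T a' b'" "a' i = v"
      "\<And>j. j \<in> S \<Longrightarrow> a' j = a j \<and> b' j = b j" "b' i \<in> V"
    proof (cases "v \<in> a ` S")
      case True
      then obtain i where "i \<in> S" "a i = v" by blast
      then show ?thesis using that[of i S a b] Exists.prems tw by (auto simp: twist_def)
    next
      case False
      obtain i where i: "i \<notin> S" using Exists.prems ex_new_if_finite infinite_UNIV_nat by blast
      obtain w where w: "w \<in> V" "twist d (insert i S) (a(i := v)) (b(i := w))"
        using twist_extend[OF tw _ i, of v] Exists.prems False v(1) by blast
      show ?thesis
        by (rule that[of i "insert i S" "a(i := v)" "b(i := w)"]) (use i w Exists.prems in auto)
    qed
    have S: "k y \<in> S" if "y \<in> free_vars \<phi>" "y \<noteq> x" for y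
      using Exists.prems(4) that by auto
    have "sat A (a' \<circ> k(x := i)) \<phi>"
      using v(2) by (rule sat_cong[THEN iffD1, rotated]) (use i S in auto)
    moreover have "(k(x := i)) ` free_vars \<phi> \<subseteq> T" using S i by auto
    ultimately have "sat A (b' \<circ> k(x := i)) \<phi>"
      using Exists.IH[of T a' b' "k(x := i)"] Exists.prems(1) i(2,4) by (simp only: wf_form.simps)
    then have "sat A ((b \<circ> k)(x := b' i)) \<phi>"
      by (rule sat_cong[THEN iffD1, rotated]) (use i S in auto)
    then show ?thesis using i carrier by auto
  qed
  show ?case using dir[of a b] dir[of b a] twist_sym Exists.prems by blast
next
  case (Neg \<phi>)
  then show ?case using Neg.IH[of S a b k] by simp
next
  case (Conj \<phi> \<psi>)
  then show ?case using Conj.IH[of S a b k] by (simp add: image_Un)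
qed

abbreviation "G \<equiv> graph_structure V E"

text \<open>
  The case of the trivial twist: finite induced subgraphs determine all first-order properties of
  their vertices in the random graph.
\<close>
lemma sat_graph:
  assumes "wf_form graph_signature \<phi>" "finite S" "realizes S g a" "realizes S g b" "k ` free_vars \<phi> \<subseteq> S"
  shows "sat G (a \<circ> k) \<phi> \<longleftrightarrow> sat G (b \<circ> k) \<phi>"
proof (rule sat_twist[where d = "\<lambda>_. False" and \<Sigma> = graph_signature and S = S])
  show "twist (\<lambda>_. False) S a b" using assms by (auto simp: twist_def realizes_def)
  fix S a b and r :: unit and "is" :: "nat list"
  assume "finite S" and tw: "twist (\<lambda>_. False) S a b"
    and len: "graph_signature r = Some (length is)" and S: "set is \<subseteq> S"
  obtain i j where ij: "is = [i, j]"
    using len by (cases "is" rule: remdups_adj.cases) (auto simp: graph_signature_def)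
  have irr: "(v, v) \<notin> E" for v using random by (auto simp: random_graph_def irrefl_def)
  show "map a is \<in> interp G r \<longleftrightarrow> map b is \<in> interp G r"
    using tw S irr by (cases "i = j") (auto simp: ij graph_structure_def twist_def)
qed (use assms in \<open>auto simp: graph_structure_def\<close>)

end

section \<open>Graphs that a reduct cannot distinguish\<close>

locale random_graph_reduct = random_graph_on V E
  for V :: "'v set" and E :: "('v \<times> 'v) set" +
  fixes \<Sigma> :: "'s signature" and A :: "('s, 'v) rel_structure"
  assumes reduct: "is_reduct \<Sigma> A graph_signature G"
begin

lemma carrier_A: "carrier A = V"
  using reduct by (simp add: is_reduct_def graph_structure_def)

definition agree :: "nat set \<Rightarrow> (nat \<Rightarrow> 'v) \<Rightarrow> (nat \<Rightarrow> 'v) \<Rightarrow> bool" where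
  "agree S x y \<longleftrightarrow> (\<forall>r is. \<Sigma> r = Some (length is) \<longrightarrow> set is \<subseteq> S \<longrightarrow>
     (map x is \<in> interp A r \<longleftrightarrow> map y is \<in> interp A r))"

lemma agree_if_same_graph:
  assumes fin: "finite S" and x: "realizes S g x" and y: "realizes S g y"
  shows "agree S x y"
  unfolding agree_def
proof (intro allI impI)
  fix r "is" assume r: "\<Sigma> r = Some (length is)" and S: "set is \<subseteq> S"
  let ?n = "length is"
  obtain \<phi> where \<phi>: "wf_form graph_signature \<phi>" "free_vars \<phi> \<subseteq> {..<?n}"
    "\<And>e. e \<in> UNIV \<rightarrow> V \<Longrightarrow> map e [0..<?n] \<in> interp A r \<longleftrightarrow> sat G e \<phi>"
    using reduct r by (fastforce simp: is_reduct_def fo_definable_def graph_structure_def)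
  have V_ne: "V \<noteq> {}" using random by (auto simp: random_graph_def)
  then obtain v where v: "v \<in> V" by blast
  define k where "k i = is ! i" for i
  have sub: "k ` free_vars \<phi> \<subseteq> S" using \<phi>(2) S unfolding k_def by (force dest: nth_mem)
  have "map z is \<in> interp A r \<longleftrightarrow> sat G (z \<circ> k) \<phi>" if z: "realizes S g z" for z
  proof -
    let ?e = "\<lambda>i. if i < ?n then z (is ! i) else v"
    have "?e \<in> UNIV \<rightarrow> V"
      using z v S by (fastforce simp: realizes_def)
    then have "map ?e [0..<?n] \<in> interp A r \<longleftrightarrow> sat G ?e \<phi>" by (rule \<phi>(3))
    moreover have "map ?e [0..<?n] = map z is" by (rule nth_equalityI) auto
    moreover have "sat G ?e \<phi> \<longleftrightarrow> sat G (z \<circ> k) \<phi>"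
      by (rule sat_cong) (use \<phi>(2) in \<open>auto simp: k_def\<close>)
    ultimately show ?thesis by simp
  qed
  then show "map x is \<in> interp A r \<longleftrightarrow> map y is \<in> interp A r"
    using x y sat_graph[OF \<phi>(1) fin x y sub] by simp
qed

text \<open>
  The relations of \<open>A\<close> depend only on the graph that a tuple induces, so it does not matter which
  realisations of \<open>g\<close> and \<open>h\<close> are compared (\<open>indistI\<close>). In particular this is an equivalence
  relation on the graphs on \<open>S\<close>.
\<close>
definition indist :: "nat set \<Rightarrow> (nat set \<Rightarrow> bool) \<Rightarrow> (nat set \<Rightarrow> bool) \<Rightarrow> bool" where
  "indist S g h \<longleftrightarrow> (\<forall>x y. realizes S g x \<longrightarrow> realizes S h y \<longrightarrow> agree S x y)"

lemma indist_cong: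
  assumes "\<And>i j. i \<in> S \<Longrightarrow> j \<in> S \<Longrightarrow> i \<noteq> j \<Longrightarrow> g {i, j} \<longleftrightarrow> g' {i, j}"
    and "\<And>i j. i \<in> S \<Longrightarrow> j \<in> S \<Longrightarrow> i \<noteq> j \<Longrightarrow> h {i, j} \<longleftrightarrow> h' {i, j}"
  shows "indist S g h \<longleftrightarrow> indist S g' h'"
  using realizes_cong[of S g g'] realizes_cong[of S h h'] assms by (auto simp: indist_def)

lemma indist_refl:
  assumes "finite S" "\<And>i j. i \<in> S \<Longrightarrow> j \<in> S \<Longrightarrow> i \<noteq> j \<Longrightarrow> g {i, j} \<longleftrightarrow> h {i, j}"
  shows "indist S g h"
  using agree_if_same_graph[OF assms(1)] realizes_cong[of S g h] assms(2) by (auto simp: indist_def)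

lemma indist_sym: "indist S g h \<Longrightarrow> indist S h g"
  by (auto simp: indist_def agree_def)

lemma indist_trans:
  assumes "finite S" "indist S f g" "indist S g h"
  shows "indist S f h"
proof -
  obtain y where "realizes S g y" using realizes_exists[OF assms(1)] .
  then show ?thesis using assms(2,3) by (auto simp: indist_def agree_def)
qed

lemma indistI:
  assumes "finite S" "realizes S g x" "realizes S h y" "agree S x y"
  shows "indist S g h"
  using assms agree_if_same_graph[OF assms(1)] unfolding indist_def agree_def by blast

text \<open>
  Examples: the constant \<open>True\<close> is a symmetry iff complementation of \<open>E\<close> leaves \<open>A\<close> invariant, and
  \<open>\<lambda>e. x \<in> e\<close> is a symmetry iff switching at a vertex does.
\<close>
definition symmetries :: "(nat set \<Rightarrow> bool) set" where
  "symmetries = {d. \<forall>S g. finite S \<longrightarrow> indist S g (\<lambda>e. g e \<noteq> d e)}"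

lemma symmetriesD: "d \<in> symmetries \<Longrightarrow> finite S \<Longrightarrow> indist S g (\<lambda>e. g e \<noteq> d e)"
  by (simp add: symmetries_def)

lemma symmetries_add:
  assumes "d \<in> symmetries" "d' \<in> symmetries"
  shows "(\<lambda>e. d e \<noteq> d' e) \<in> symmetries"
  unfolding symmetries_def
proof (intro CollectI allI impI)
  fix S :: "nat set" and g assume S: "finite S"
  have "indist S g (\<lambda>e. (g e \<noteq> d e) \<noteq> d' e)"
    using indist_trans[OF S symmetriesD[OF assms(1) S] symmetriesD[OF assms(2) S]] .
  moreover have "(\<lambda>e. (g e \<noteq> d e) \<noteq> d' e) = (\<lambda>e. g e \<noteq> (d e \<noteq> d' e))" by auto
  ultimately show "indist S g (\<lambda>e. g e \<noteq> (d e \<noteq> d' e))" by simp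
qed

lemma symmetries_local:
  assumes "\<And>S. finite S \<Longrightarrow> \<exists>d'\<in>symmetries. \<forall>i\<in>S. \<forall>j\<in>S. i \<noteq> j \<longrightarrow> (d {i, j} \<longleftrightarrow> d' {i, j})"
  shows "d \<in> symmetries"
  unfolding symmetries_def
proof (intro CollectI allI impI)
  fix S :: "nat set" and g assume S: "finite S"
  then obtain d' where d': "d' \<in> symmetries" "\<forall>i\<in>S. \<forall>j\<in>S. i \<noteq> j \<longrightarrow> (d {i, j} \<longleftrightarrow> d' {i, j})"
    using assms by blast
  show "indist S g (\<lambda>e. g e \<noteq> d e)"
    using symmetriesD[OF d'(1) S, of g] by (rule indist_cong[THEN iffD1, rotated -1]) (use d'(2) in auto)
qed

lemma symmetries_cong:
  assumes "d \<in> symmetries" "\<And>i j. i \<noteq> j \<Longrightarrow> d {i, j} \<longleftrightarrow> d' {i, j}"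
  shows "d' \<in> symmetries"
  by (rule symmetries_local) (use assms in blast)

lemma symmetries_zero: "(\<lambda>_. False) \<in> symmetries"
  by (auto simp: symmetries_def intro: indist_refl)

lemma sat_symmetry:
  assumes d: "d \<in> symmetries" and tw: "twist d S a b" and "finite S" "wf_form \<Sigma> \<phi>" "k ` free_vars \<phi> \<subseteq> S"
  shows "sat A (a \<circ> k) \<phi> \<longleftrightarrow> sat A (b \<circ> k) \<phi>"
proof (rule sat_twist[OF carrier_A _ \<open>wf_form \<Sigma> \<phi>\<close> \<open>finite S\<close> tw])
  fix S a b r "is"
  assume S: "finite S" and tw: "twist d S a b" and r: "\<Sigma> r = Some (length is)" "set is \<subseteq> S"
  have "realizes S (graph_of S a) a"
    using tw by (intro realizes_graph_of) (auto simp: twist_def)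
  moreover have "realizes S (\<lambda>e. graph_of S a e \<noteq> d e) b"
    using tw by (auto simp: realizes_def twist_def graph_of_pair)
  ultimately have "agree S a b"
    using symmetriesD[OF d S, of "graph_of S a"] by (auto simp: indist_def)
  then show "map a is \<in> interp A r \<longleftrightarrow> map b is \<in> interp A r"
    using r by (auto simp: agree_def)
qed (use assms in auto)

end

section \<open>Coding edges by order types\<close>

text \<open>
  The aim is a family of codes, lists of length \<open>N\<close>, for the vertices \<open>i < N\<close> of a graph \<open>F\<close>, such
  that the edge between \<open>i\<close> and \<open>j\<close> can be read off from the order type of their two codes and,
  conversely, this order type depends on \<open>i\<close>, \<open>j\<close> and that edge only. Each unordered pair
  \<open>{i, q}\<close> owns a block of two consecutive numbers. Entry \<open>q\<close> of the code of \<open>i\<close> lies in this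
  block, and so does entry \<open>i\<close> of the code of \<open>q\<close>; which of the two is smaller says whether there is
  an edge. Blocks are numbered symmetrically by \<open>block\<close>; the sum \<open>i + q\<close> and the minimum of
  \<open>i\<close> and \<open>q\<close> are quotient and remainder modulo \<open>N\<close>.
\<close>

definition block :: "nat \<Rightarrow> nat \<Rightarrow> nat \<Rightarrow> nat" where
  "block N i q = (i + q) * N + min i q"

definition cell :: "nat \<Rightarrow> (nat set \<Rightarrow> bool) \<Rightarrow> nat \<Rightarrow> nat \<Rightarrow> nat" where
  "cell N F i q = 2 * block N i q + (if i \<noteq> q \<and> (i < q) \<noteq> F {i, q} then 1 else 0)"

definition code :: "nat \<Rightarrow> (nat set \<Rightarrow> bool) \<Rightarrow> nat \<Rightarrow> nat list" where
  "code N F i = map (cell N F i) [0..<N]"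

lemma block_sym: "block N i q = block N q i"
  by (simp add: block_def add.commute min.commute)

lemma block_inj:
  assumes "i < N" "q < N" "j < N" "r < N" "block N i q = block N j r"
  shows "i = j \<and> q = r \<or> i = r \<and> q = j"
proof -
  have "block N i q div N = i + q" "block N j r div N = j + r"
    "block N i q mod N = min i q" "block N j r mod N = min j r"
    using assms(1-4) by (auto simp: block_def min_def)
  then have "i + q = j + r" "min i q = min j r" using assms(5) by auto
  then show ?thesis by (auto simp: min_def split: if_splits)
qed

lemma cell_bound:
  assumes "i < N" "q < N"
  shows "cell N F i q < 4 * N * N"
proof -
  have "(i + q) * N + min i q < (i + q + 1) * N" using assms by (auto simp: min_def)
  also have "\<dots> \<le> (2 * N) * N" using assms by (intro mult_right_mono) auto
  finally have "block N i q < 2 * N * N" by (simp add: block_def)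
  then show ?thesis by (simp add: cell_def)
qed

lemma cell_div_2: "cell N F i q div 2 = block N i q"
  by (simp add: cell_def)

lemma cell_less_iff_edge: "i < j \<Longrightarrow> cell N F i j < cell N F j i \<longleftrightarrow> F {i, j}"
  by (simp add: cell_def block_sym[of N i j] insert_commute)

lemma cell_neq: "i \<noteq> j \<Longrightarrow> cell N F i j \<noteq> cell N F j i"
  by (auto simp: cell_def block_sym[of N i j] insert_commute)

lemma cell_inj:
  assumes "i < N" "q < N" "j < N" "r < N" "cell N F i q = cell N F j r"
  shows "i = j \<and> q = r"
proof -
  have "block N i q = block N j r" using assms(5) cell_div_2 by metis
  then show ?thesis using block_inj[OF assms(1-4)] cell_neq[of i q N F] assms(5) by auto
qed

text \<open>
  Entries in different blocks compare as their blocks do; two different entries in the same block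
  belong to the pair \<open>{a, b}\<close>, for which \<open>F\<close> and \<open>F'\<close> agree.
\<close>
lemma cell_order:
  assumes "a < N" "q < N" "b < N" "r < N" and F: "F {a, b} = F' {a, b}"
  shows "cell N F a q < cell N F b r \<longleftrightarrow> cell N F' a q < cell N F' b r"
proof (cases "block N a q = block N b r")
  case True
  from block_inj[OF assms(1-4) this] show ?thesis
  proof
    assume "a = r \<and> q = b"
    then show ?thesis using F by (simp add: cell_def insert_commute)
  qed simp
next
  case False
  have "cell N H a q < cell N H b r \<longleftrightarrow> block N a q < block N b r" for H
    using False by (auto simp: cell_def)
  then show ?thesis by simp
qed

lemma cell_order_same:
  assumes "i < N" "q < N" "r < N"
  shows "cell N F i q < cell N F i r \<longleftrightarrow> cell N F' i q < cell N F' i r"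
proof (cases "q = r")
  case False
  then have neq: "block N i q \<noteq> block N i r"
    using block_inj[OF assms(1,2) assms(1,3)] by metis
  have "cell N H i q < cell N H i r \<longleftrightarrow> block N i q < block N i r" for H
    using neq by (auto simp: cell_def)
  then show ?thesis by simp
qed simp

lemma length_code [simp]: "length (code N F i) = N"
  by (simp add: code_def)

lemma nth_code [simp]: "q < N \<Longrightarrow> code N F i ! q = cell N F i q"
  by (simp add: code_def)

lemma codes_in_tuples:
  "i < N \<Longrightarrow> j < N \<Longrightarrow> code N F i @ code N F j \<in> tuples (2 * N) {..<4 * N * N}"
  using cell_bound by (fastforce simp: tuples_def code_def)

lemma distinct_codes:
  assumes "i < N" "j < N" "i \<noteq> j"
  shows "distinct (code N F i @ code N F j)"
  using assms cell_inj by (fastforce simp: code_def distinct_map inj_on_def)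

lemma same_order_codes:
  assumes "i < N" "j < N" "F {i, j} = F' {i, j}"
    and "i \<noteq> j"
  shows "same_order (code N F i @ code N F j) (code N F' i @ code N F' j)"
proof -
  have nth: "(code N H i @ code N H j) ! a = cell N H (if a < N then i else j) (if a < N then a else a - N)"
    if "a < 2 * N" for a H
    using that by (auto simp: nth_append)
  have "(code N F i @ code N F j) ! a < (code N F i @ code N F j) ! b \<longleftrightarrow>
        (code N F' i @ code N F' j) ! a < (code N F' i @ code N F' j) ! b"
    if ab: "a < 2 * N" "b < 2 * N" for a b
  proof (cases "(a < N) = (b < N)")
    case True
    have "cell N F (if a < N then i else j) (if a < N then a else a - N) <
        cell N F (if a < N then i else j) (if b < N then b else b - N) \<longleftrightarrow>
      cell N F' (if a < N then i else j) (if a < N then a else a - N) <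
        cell N F' (if a < N then i else j) (if b < N then b else b - N)"
      using assms(1,2) ab by (intro cell_order_same) auto
    then show ?thesis using True by (simp add: nth ab)
  next
    case False
    then consider "a < N" "\<not> b < N" | "\<not> a < N" "b < N" by blast
    then show ?thesis
    proof cases
      case 1
      then show ?thesis
        using cell_order[of i N a j "b - N" F F'] assms ab by (simp add: nth)
    next
      case 2
      then show ?thesis
        using cell_order[of j N "a - N" i b F F'] assms ab by (simp add: nth insert_commute)
    qed
  qed
  then show ?thesis by (simp add: same_order_def mult_2)
qed

text \<open>
  Labels are assigned in the order of the keys. The spare label \<open>l\<close> above all others is what makes
  the induction work; later it serves as a common partner for all vertices.
\<close>
lemma increasing_labelling:
  fixes key :: "'i \<Rightarrow> nat" and H :: "nat set"
  assumes "finite S"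
  shows "finite H \<Longrightarrow> card H = Suc (card S) \<Longrightarrow> \<exists>lab l. inj_on lab S \<and> lab ` S \<subseteq> H \<and> l \<in> H \<and>
    (\<forall>i\<in>S. lab i < l) \<and> (\<forall>i\<in>S. \<forall>j\<in>S. lab i < lab j \<longrightarrow> key i \<le> key j)"
  using assms
proof (induction S arbitrary: H rule: finite_ranking_induct[where f = key])
  case empty
  then show ?case by (auto simp: card_Suc_eq)
next
  case (insert m S)
  show ?case
  proof (cases "m \<in> S")
    case True
    then show ?thesis using insert by (simp add: insert_absorb)
  next
    case False
    have H: "H \<noteq> {}" using insert.prems by auto
    have "card (H - {Max H}) = Suc (card S)"
      using insert.prems False insert.hyps H by simp
    then obtain lab l where lab: "inj_on lab S" "lab ` S \<subseteq> H - {Max H}" "l \<in> H - {Max H}"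
      "\<forall>i\<in>S. lab i < l" "\<forall>i\<in>S. \<forall>j\<in>S. lab i < lab j \<longrightarrow> key i \<le> key j"
      using insert.IH[of "H - {Max H}"] insert.prems(1) by auto
    have l: "l < Max H"
      using lab(3) insert.prems(1) Max_ge[of H l] by (simp add: order.not_eq_order_implies_strict)
    let ?lab = "lab(m := l)"
    have "inj_on ?lab (insert m S)"
      using lab False by (auto simp: inj_on_def)
    moreover have "?lab ` insert m S \<subseteq> H" using lab by auto
    moreover have "\<forall>i\<in>insert m S. ?lab i < Max H" using lab(4) l by auto
    moreover have "key i \<le> key j"
      if ij: "i \<in> insert m S" "j \<in> insert m S" "?lab i < ?lab j" for i j
    proof (cases "j = m")
      case True
      then show ?thesis using ij insert.hyps(2) by auto
    next
      case False
      have "i \<noteq> m" using ij lab(4) False by auto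
      then show ?thesis using ij lab(5) False by auto
    qed
    moreover have "Max H \<in> H" using H insert.prems(1) by simp
    ultimately have "inj_on ?lab (insert m S) \<and> ?lab ` insert m S \<subseteq> H \<and> Max H \<in> H \<and>
        (\<forall>i\<in>insert m S. ?lab i < Max H) \<and>
        (\<forall>i\<in>insert m S. \<forall>j\<in>insert m S. ?lab i < ?lab j \<longrightarrow> key i \<le> key j)"
      by blast
    then show ?thesis by (intro exI)
  qed
qed

text \<open>
  If each \<open>b\<close> in \<open>B\<close> failed for some \<open>F\<close>, directedness would give one \<open>F\<close> for which all of them fail.
\<close>
lemma finite_directed_choice:
  assumes "finite B" "\<And>F. \<exists>b\<in>B. Q b F"
    and dir: "\<And>F F'. \<exists>F''. \<forall>b. Q b F'' \<longrightarrow> Q b F \<and> Q b F'"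
  shows "\<exists>b\<in>B. \<forall>F. Q b F"
proof (rule ccontr)
  assume neg: "\<not> (\<exists>b\<in>B. \<forall>F. Q b F)"
  have "\<exists>F. \<forall>b\<in>B'. \<not> Q b F" if "B' \<subseteq> B" for B'
    using finite_subset[OF that assms(1)] that
  proof (induction B')
    case (insert b B')
    then obtain F where "\<forall>b\<in>B'. \<not> Q b F" by auto
    moreover obtain F' where "\<not> Q b F'" using neg insert.prems by auto
    ultimately show ?case using dir[of F F'] by auto
  qed simp
  then show False using assms(2) by blast
qed

section \<open>Canonical behaviour over finitely many constants\<close>

context random_graph_on
begin

text \<open>
  The type of a vertex outside \<open>C\<close> is its set of neighbours in \<open>C\<close>; \<open>\<tau>\<close> prescribes the types. The
  pair \<open>B\<close>, \<open>N\<close> is the behaviour of \<open>f\<close>: \<open>B\<close> determines edges in the image of \<open>f\<close> between vertices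
  outside \<open>C\<close> from the two types and the edge between them, and \<open>N\<close> determines edges between images
  of constants and of other vertices. Types enter \<open>B\<close> as an unordered pair, so the behaviour cannot
  depend on any ordering of the vertices.
\<close>
definition canonical ::
  "('v \<Rightarrow> 'v) \<Rightarrow> 'v set \<Rightarrow> ('v set set \<times> bool) set \<Rightarrow> ('v \<times> 'v set) set \<Rightarrow>
    nat set \<Rightarrow> (nat set \<Rightarrow> bool) \<Rightarrow> (nat \<Rightarrow> 'v set) \<Rightarrow> (nat \<Rightarrow> 'v) \<Rightarrow> bool" where
  "canonical f C B N S g \<tau> x \<longleftrightarrow>
     realizes S g x \<and> x ` S \<subseteq> V - C \<and> (\<forall>i\<in>S. \<forall>c\<in>C. (x i, c) \<in> E \<longleftrightarrow> c \<in> \<tau> i) \<and>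
     (\<forall>i\<in>S. \<forall>j\<in>S. i \<noteq> j \<longrightarrow> ((f (x i), f (x j)) \<in> E \<longleftrightarrow> (\<tau> ` {i, j}, g {i, j}) \<in> B)) \<and>
     (\<forall>i\<in>S. \<forall>c\<in>C. (f (x i), f c) \<in> E \<longleftrightarrow> (c, \<tau> i) \<in> N)"

text \<open>
  The big graph in which the copy is found has as vertices triples of a type \<open>t\<close>, a label \<open>i < N\<close>
  and a list \<open>D\<close> of \<open>N\<close> numbers, adjacent as the codes above demand. Colours are the edges of the
  image of \<open>f\<close>. The Ramsey theorem for order types makes the colour of a pair of codes depend only on
  types, labels and the edge between the two, and this for all graphs on the label set at the same time. So
  the graph need not be known when the dependence on labels is removed by a second application of
  Ramsey, to pairs of labels. The edges to the constants are part of the colour of a pair and could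
  therefore depend on the partner; pairing every vertex with a spare isolated one removes this dependence.
\<close>
lemma canonical_copy_exists:
  assumes C: "finite C" "C \<subseteq> V" and S: "finite S" and \<tau>: "\<And>i. i \<in> S \<Longrightarrow> \<tau> i \<subseteq> C"
  shows "\<exists>B \<in> Pow (Pow (Pow C) \<times> UNIV). \<exists>NU \<in> Pow (C \<times> Pow C). \<exists>x. canonical f C B NU S g \<tau> x"
proof -
  define K where "K = (UNIV :: bool set) \<times> Pow C"
  have finK: "finite K" using C by (simp add: K_def)
  have "finite (Pow (Pow C \<times> Pow C \<times> (UNIV :: bool set) \<times> K))" using finK C by simp
  from ramsey_finite_colours[OF this, of 2 "Suc (card S)"] obtain N :: nat where N:
    "\<forall>\<kappa> :: nat set \<Rightarrow> ('v set \<times> 'v set \<times> bool \<times> bool \<times> 'v set) set.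
      \<kappa> \<in> [{..<N}]\<^bsup>2\<^esup> \<rightarrow> Pow (Pow C \<times> Pow C \<times> UNIV \<times> K) \<longrightarrow>
      (\<exists>H\<in>[{..<N}]\<^bsup>Suc (card S)\<^esup>. \<exists>k. \<forall>X\<in>[H]\<^bsup>2\<^esup>. \<kappa> X = k)" ..
  have "finite (Pow (Pow C \<times> Pow C \<times> {..<N} \<times> {..<N} \<times> K))" using finK C by simp
  from ramsey_order_types[OF this, of "2 * N" "4 * N * N"] obtain M :: nat where M:
    "\<forall>col :: nat list \<Rightarrow> ('v set \<times> 'v set \<times> nat \<times> nat \<times> bool \<times> 'v set) set.
      (\<forall>L\<in>tuples (2 * N) {..<M}. col L \<in> Pow (Pow C \<times> Pow C \<times> {..<N} \<times> {..<N} \<times> K)) \<longrightarrow>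
      (\<exists>z. strict_mono_on {..<4 * N * N} z \<and> z ` {..<4 * N * N} \<subseteq> {..<M} \<and>
        (\<forall>us\<in>tuples (2 * N) {..<4 * N * N}. \<forall>vs\<in>tuples (2 * N) {..<4 * N * N}.
          distinct us \<and> distinct vs \<and> same_order us vs \<longrightarrow> col (map z us) = col (map z vs)))" ..
  define W where "W = Pow C \<times> {..<N} \<times> tuples N {..<M}"
  have finW: "finite W" unfolding W_def by (intro finite_cartesian_product finite_tuples) (use C in auto)
  define adj :: "'v set \<times> nat \<times> nat list \<Rightarrow> 'v set \<times> nat \<times> nat list \<Rightarrow> bool" where
    "adj = (\<lambda>(t, i, D) (t', j, D'). i < j \<and> D ! j < D' ! i \<or> j < i \<and> D' ! i < D ! j)"
  have adj_sym: "adj u v \<longleftrightarrow> adj v u" for u v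
    by (cases u; cases v) (auto simp: adj_def)
  from realize_over[where r = adj and ty = fst, OF finW C adj_sym] obtain y where y':
    "inj_on y W \<and> y ` W \<subseteq> V - C \<and>
     (\<forall>u\<in>W. \<forall>v\<in>W. u \<noteq> v \<longrightarrow> ((y u, y v) \<in> E \<longleftrightarrow> adj u v)) \<and>
     (\<forall>u\<in>W. \<forall>c\<in>C. (y u, c) \<in> E \<longleftrightarrow> c \<in> fst u)" ..
  then have y: "inj_on y W" "y ` W \<subseteq> V - C"
    "\<And>u v. u \<in> W \<Longrightarrow> v \<in> W \<Longrightarrow> u \<noteq> v \<Longrightarrow> (y u, y v) \<in> E \<longleftrightarrow> adj u v"
    "\<And>u c. u \<in> W \<Longrightarrow> c \<in> C \<Longrightarrow> (y u, c) \<in> E \<longleftrightarrow> c \<in> fst u"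
    by simp_all
  (* the colour of a pair of vertices: the edge between their images, and the edges from the
     image of the first one to the images of the constants *)
  define vcol where "vcol u v = ((f (y u), f (y v)) \<in> E, {c\<in>C. (f (y u), f c) \<in> E})" for u v
  have vcolK: "vcol u v \<in> K" for u v by (auto simp: vcol_def K_def)
  define col where "col L = {(t, t', i, j, k). t \<subseteq> C \<and> t' \<subseteq> C \<and> i < N \<and> j < N \<and>
    k = vcol (t, i, take N L) (t', j, drop N L)}" for L
  have "\<forall>L\<in>tuples (2 * N) {..<M}. col L \<in> Pow (Pow C \<times> Pow C \<times> {..<N} \<times> {..<N} \<times> K)"
    using vcolK by (auto simp: col_def)
  from M[THEN spec, THEN mp, OF this] obtain z where
    "strict_mono_on {..<4 * N * N} z \<and> z ` {..<4 * N * N} \<subseteq> {..<M} \<and>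
      (\<forall>us\<in>tuples (2 * N) {..<4 * N * N}. \<forall>vs\<in>tuples (2 * N) {..<4 * N * N}.
        distinct us \<and> distinct vs \<and> same_order us vs \<longrightarrow> col (map z us) = col (map z vs))" ..
  then have z: "strict_mono_on {..<4 * N * N} z" "z ` {..<4 * N * N} \<subseteq> {..<M}"
    "\<And>us vs. us \<in> tuples (2 * N) {..<4 * N * N} \<Longrightarrow> vs \<in> tuples (2 * N) {..<4 * N * N} \<Longrightarrow>
       distinct us \<Longrightarrow> distinct vs \<Longrightarrow> same_order us vs \<Longrightarrow> col (map z us) = col (map z vs)"
    by simp_all
  define D where "D F i = map z (code N F i)" for F i
  (* by the choice of \<open>z\<close>, the colour of a pair of codes can be computed in the complete or in the
     empty graph on the label set *)
  define c where "c e t t' i j = vcol (t, i, D (\<lambda>_. e) i) (t', j, D (\<lambda>_. e) j)" for e t t' i j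
  have vcol_eq: "vcol (t, i, D F i) (t', j, D F j) = c (F {i, j}) t t' i j"
    if "i < j" "j < N" "t \<subseteq> C" "t' \<subseteq> C" for F i j t t'
  proof -
    have eq: "col (map z (code N F i @ code N F j)) =
      col (map z (code N (\<lambda>_. F {i, j}) i @ code N (\<lambda>_. F {i, j}) j))"
      using that by (intro z(3) codes_in_tuples distinct_codes same_order_codes) auto
    have iff: "(t, t', i, j, k) \<in> col (map z (code N H i @ code N H j)) \<longleftrightarrow>
        k = vcol (t, i, D H i) (t', j, D H j)" for k H
      using that by (simp add: col_def D_def)
    have "(t, t', i, j, vcol (t, i, D F i) (t', j, D F j)) \<in> col (map z (code N F i @ code N F j))"
      by (rule iff[THEN iffD2]) simp
    then show ?thesis unfolding eq c_def by (rule iff[THEN iffD1])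
  qed
  define \<kappa> where "\<kappa> X = {(t, t', e, k). t \<subseteq> C \<and> t' \<subseteq> C \<and> k = c e t t' (Min X) (Max X)}" for X
  have "\<kappa> \<in> [{..<N}]\<^bsup>2\<^esup> \<rightarrow> Pow (Pow C \<times> Pow C \<times> UNIV \<times> K)"
    using vcolK by (auto simp: \<kappa>_def c_def)
  from N[THEN spec, THEN mp, OF this] obtain H where H: "H \<in> [{..<N}]\<^bsup>Suc (card S)\<^esup>"
    and "\<exists>k. \<forall>X\<in>[H]\<^bsup>2\<^esup>. \<kappa> X = k" ..
  then obtain k where k: "\<And>X. X \<in> [H]\<^bsup>2\<^esup> \<Longrightarrow> \<kappa> X = k" by auto
  define cc where "cc e t t' = the_elem {a. (t, t', e, a) \<in> k}" for e t t'
  have c_eq: "c e t t' i j = cc e t t'" if "i \<in> H" "j \<in> H" "i < j" "t \<subseteq> C" "t' \<subseteq> C" for e t t' i j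
  proof -
    have "\<kappa> {i, j} = k" using that by (intro k) simp
    moreover have "Min {i, j} = i" "Max {i, j} = j" using that by auto
    ultimately have "{a. (t, t', e, a) \<in> k} = {c e t t' i j}" using that by (auto simp: \<kappa>_def)
    then show ?thesis by (simp add: cc_def)
  qed
  (* labels increase with the rank \<open>\<theta>\<close> of the type: the colour \<open>cc e t t'\<close> refers to pairs where
     \<open>t\<close> belongs to the smaller label, and with this choice the unordered pair of
     types determines which of \<open>cc e t t'\<close> and \<open>cc e t' t\<close> describes a pair of vertices *)
  obtain \<theta> :: "'v set \<Rightarrow> nat" where \<theta>: "inj_on \<theta> (Pow C)"
    using finite_imp_inj_to_nat_seg[of "Pow C"] C by auto
  have H': "finite H" "H \<subseteq> {..<N}" "card H = Suc (card S)" using H by (auto simp: nsets_def)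
  from increasing_labelling[OF S H'(1,3), of "\<theta> \<circ> \<tau>"] obtain lab l where lab: "inj_on lab S" "lab ` S \<subseteq> H"
    "l \<in> H" "\<And>i. i \<in> S \<Longrightarrow> lab i < l"
    "\<And>i j. i \<in> S \<Longrightarrow> j \<in> S \<Longrightarrow> lab i < lab j \<Longrightarrow> \<theta> (\<tau> i) \<le> \<theta> (\<tau> j)"
    by (auto simp: comp_def)
  have labH: "lab i \<in> H" if "i \<in> S" for i using that lab(2) by blast
  have labN: "lab i < N" if "i \<in> S" for i using that lab(2) H'(2) by auto
  define F where "F e \<longleftrightarrow> (\<exists>i\<in>S. \<exists>j\<in>S. e = {lab i, lab j} \<and> g {i, j})" for e
  have F_lab: "F {lab i, lab j} \<longleftrightarrow> g {i, j}" if "i \<in> S" "j \<in> S" for i j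
  proof
    assume "F {lab i, lab j}"
    then obtain i' j' where "i' \<in> S" "j' \<in> S" "lab ` {i, j} = lab ` {i', j'}" "g {i', j'}"
      by (auto simp: F_def)
    then show "g {i, j}" using inj_on_image_eq_iff[OF lab(1), of "{i, j}" "{i', j'}"] that by simp
  qed (use that in \<open>auto simp: F_def\<close>)
  have F_l: "\<not> F {lab i, l}" if "i \<in> S" for i
    using lab(4) by (fastforce simp: F_def doubleton_eq_iff)
  define v where "v i = (\<tau> i, lab i, D F (lab i))" for i
  define x where "x i = y (v i)" for i
  have D_tuples: "D F i \<in> tuples N {..<M}" if "i < N" for i F
    using that z(2) cell_bound[OF that] by (fastforce simp: D_def tuples_def code_def)
  have vW: "v i \<in> W" if "i \<in> S" for i
    using that \<tau> labN D_tuples by (auto simp: v_def W_def)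
  have v_inj: "inj_on v S" using lab(1) by (auto simp: v_def inj_on_def)
  have adj_v: "adj (v i) (v j) \<longleftrightarrow> g {i, j}" if "i \<in> S" "j \<in> S" "lab i < lab j" for i j
  proof -
    have "cell N F (lab i) (lab j) < 4 * N * N" "cell N F (lab j) (lab i) < 4 * N * N"
      using labN that by (auto intro: cell_bound)
    then have "z (cell N F (lab i) (lab j)) < z (cell N F (lab j) (lab i)) \<longleftrightarrow> g {i, j}"
      using z(1) cell_less_iff_edge[OF that(3), of N F] F_lab that
      by (metis lessThan_iff strict_mono_on_less)
    then show ?thesis using that labN by (simp add: adj_def v_def D_def)
  qed
  define B where "B = {({t, t'}, e) | t t' e. t \<subseteq> C \<and> t' \<subseteq> C \<and> \<theta> t \<le> \<theta> t' \<and> fst (cc e t t')}"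
  define NU where "NU = {(a, t). a \<in> C \<and> t \<subseteq> C \<and> a \<in> snd (cc False t {})}"
  have pair: "((x i, x j) \<in> E \<longleftrightarrow> g {i, j}) \<and> ((f (x i), f (x j)) \<in> E \<longleftrightarrow> (\<tau> ` {i, j}, g {i, j}) \<in> B)"
    if ij: "i \<in> S" "j \<in> S" "lab i < lab j" for i j
  proof
    have "v i \<noteq> v j" using ij by (auto simp: v_def)
    then show "(x i, x j) \<in> E \<longleftrightarrow> g {i, j}"
      using y(3) vW adj_v ij by (simp add: x_def)
    have "vcol (v i) (v j) = cc (g {i, j}) (\<tau> i) (\<tau> j)"
      using vcol_eq[of "lab i" "lab j" "\<tau> i" "\<tau> j" F] c_eq[of "lab i" "lab j" "\<tau> i" "\<tau> j"] ij labN \<tau> labH F_lab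
      by (auto simp: v_def)
    then have "(f (x i), f (x j)) \<in> E \<longleftrightarrow> fst (cc (g {i, j}) (\<tau> i) (\<tau> j))"
      by (metis fst_conv vcol_def x_def)
    also have "\<dots> \<longleftrightarrow> ({\<tau> i, \<tau> j}, g {i, j}) \<in> B"
    proof
      assume "({\<tau> i, \<tau> j}, g {i, j}) \<in> B"
      then obtain t t' where t: "{\<tau> i, \<tau> j} = {t, t'}" "t \<subseteq> C" "t' \<subseteq> C" "\<theta> t \<le> \<theta> t'" "fst (cc (g {i, j}) t t')"
        by (auto simp: B_def)
      have "\<theta> (\<tau> i) \<le> \<theta> (\<tau> j)" using lab(5) ij by blast
      moreover have "\<theta> t = \<theta> t' \<Longrightarrow> t = t'"
        using t(2,3) \<theta> by (simp add: inj_on_def)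
      ultimately have "t = \<tau> i \<and> t' = \<tau> j"
        using t(1,4) by (metis doubleton_eq_iff le_antisym)
      then show "fst (cc (g {i, j}) (\<tau> i) (\<tau> j))" using t by simp
    next
      assume "fst (cc (g {i, j}) (\<tau> i) (\<tau> j))"
      moreover have "\<theta> (\<tau> i) \<le> \<theta> (\<tau> j)" using lab(5) ij by blast
      ultimately show "({\<tau> i, \<tau> j}, g {i, j}) \<in> B"
        unfolding B_def using ij(1,2) \<tau>
        by (intro CollectI exI[of _ "\<tau> i"] exI[of _ "\<tau> j"] exI[of _ "g {i, j}"]) simp
    qed
    finally show "(f (x i), f (x j)) \<in> E \<longleftrightarrow> (\<tau> ` {i, j}, g {i, j}) \<in> B" by simp
  qed
  have pair': "((x i, x j) \<in> E \<longleftrightarrow> g {i, j}) \<and> ((f (x i), f (x j)) \<in> E \<longleftrightarrow> (\<tau> ` {i, j}, g {i, j}) \<in> B)"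
    if ij: "i \<in> S" "j \<in> S" "i \<noteq> j" for i j
  proof -
    have "lab i \<noteq> lab j" using ij lab(1) by (auto simp: inj_on_def)
    then consider "lab i < lab j" | "lab j < lab i" by linarith
    then show ?thesis
    proof cases
      case 1
      then show ?thesis using pair ij by blast
    next
      case 2
      then show ?thesis
        using pair[of j i] ij sym_E[of "x i" "x j"] sym_E[of "f (x i)" "f (x j)"] by (simp add: insert_commute)
    qed
  qed
  have vert: "(f (x i), f a) \<in> E \<longleftrightarrow> (a, \<tau> i) \<in> NU" if "i \<in> S" "a \<in> C" for i a
  proof -
    have i: "lab i < l" "l < N" "\<tau> i \<subseteq> C" "lab i \<in> H" "F {lab i, l} = False"
      using that lab(3,4) H'(2) \<tau> labH F_l by auto
    have "vcol (v i) ({}, l, D F l) = c False (\<tau> i) {} (lab i) l"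
      using vcol_eq[OF i(1,2,3), of "{}" F] i(5) by (simp add: v_def)
    also have "\<dots> = cc False (\<tau> i) {}" using c_eq[OF i(4) lab(3) i(1,3)] by simp
    finally have vc: "vcol (v i) ({}, l, D F l) = cc False (\<tau> i) {}" .
    have "{c\<in>C. (f (x i), f c) \<in> E} = snd (vcol (v i) ({}, l, D F l))"
      by (simp add: vcol_def x_def)
    then have "(f (x i), f a) \<in> E \<longleftrightarrow> a \<in> snd (cc False (\<tau> i) {})"
      unfolding vc using that(2) by blast
    then show ?thesis using that(2) i(3) by (simp add: NU_def)
  qed
  have "canonical f C B NU S g \<tau> x"
    unfolding canonical_def realizes_def
  proof (intro conjI)
    have "inj_on y (v ` S)" using y(1) by (rule inj_on_subset) (use vW in auto)
    then have "inj_on (y \<circ> v) S" using v_inj by (intro comp_inj_on)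
    then show "inj_on x S" by (simp add: x_def[abs_def] comp_def)
    have "x i \<in> V - C" if "i \<in> S" for i
      using y(2) vW[OF that] by (auto simp: x_def)
    then show "x ` S \<subseteq> V" "x ` S \<subseteq> V - C" by blast+
    show "\<forall>i\<in>S. \<forall>c\<in>C. ((x i, c) \<in> E) = (c \<in> \<tau> i)"
      using y(4)[OF vW] by (simp add: x_def v_def)
    show "\<forall>i\<in>S. \<forall>j\<in>S. i \<noteq> j \<longrightarrow> ((x i, x j) \<in> E) = g {i, j}" using pair' by simp
    show "\<forall>i\<in>S. \<forall>j\<in>S. i \<noteq> j \<longrightarrow> ((f (x i), f (x j)) \<in> E) = ((\<tau> ` {i, j}, g {i, j}) \<in> B)"
      using pair' by simp
    show "\<forall>i\<in>S. \<forall>c\<in>C. ((f (x i), f c) \<in> E) = ((c, \<tau> i) \<in> NU)" using vert by simp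
  qed
  moreover have "B \<in> Pow (Pow (Pow C) \<times> UNIV)" by (auto simp: B_def)
  moreover have "NU \<in> Pow (C \<times> Pow C)" by (auto simp: NU_def)
  ultimately show ?thesis by (intro bexI exI)
qed

lemma canonical_reindex:
  assumes x: "canonical f C B N T h \<sigma> x" and \<pi>: "inj_on \<pi> S" "\<pi> ` S \<subseteq> T"
    and "\<And>i. i \<in> S \<Longrightarrow> \<sigma> (\<pi> i) = \<tau> i"
    and "\<And>i j. i \<in> S \<Longrightarrow> j \<in> S \<Longrightarrow> h {\<pi> i, \<pi> j} \<longleftrightarrow> g {i, j}"
  shows "canonical f C B N S g \<tau> (x \<circ> \<pi>)"
proof -
  have "\<pi> i \<in> T" if "i \<in> S" for i using \<pi>(2) that by blast
  moreover have "\<pi> i \<noteq> \<pi> j" if "i \<in> S" "j \<in> S" "i \<noteq> j" for i j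
    using \<pi>(1) that by (auto simp: inj_on_def)
  moreover have "inj_on (x \<circ> \<pi>) S"
    using x \<pi> by (intro comp_inj_on) (auto simp: canonical_def realizes_def intro: inj_on_subset)
  moreover have "x (\<pi> i) \<in> V - C" if "i \<in> S" for i
    using x \<pi>(2) that by (auto simp: canonical_def)
  ultimately show ?thesis
    using x assms(4,5) by (auto simp: canonical_def realizes_def)
qed

text \<open>
  There are finitely many behaviours over \<open>C\<close>, and a behaviour that works for the disjoint union of two
  typed graphs works for both; so one behaviour works for all typed graphs at once.
\<close>
lemma canonical_behaviour:
  assumes C: "finite C" "C \<subseteq> V"
  shows "\<exists>B N. \<forall>S g \<tau>. finite S \<and> (\<forall>i\<in>S. \<tau> i \<subseteq> C) \<longrightarrow> (\<exists>x. canonical f C B N S g \<tau> x)"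
proof -
  define Q where "Q = (\<lambda>(B, N) (S, g, \<tau>). finite S \<and> (\<forall>i\<in>S. \<tau> i \<subseteq> C) \<longrightarrow> (\<exists>x. canonical f C B N S g \<tau> x))"
  have "\<exists>b\<in>Pow (Pow (Pow C) \<times> UNIV) \<times> Pow (C \<times> Pow C). \<forall>F. Q b F"
  proof (rule finite_directed_choice)
    show "finite (Pow (Pow (Pow C) \<times> (UNIV :: bool set)) \<times> Pow (C \<times> Pow C))" using C by simp
    show "\<exists>b\<in>Pow (Pow (Pow C) \<times> UNIV) \<times> Pow (C \<times> Pow C). Q b F" for F
    proof (cases F)
      case (fields S g \<tau>)
      show ?thesis
      proof (cases "finite S \<and> (\<forall>i\<in>S. \<tau> i \<subseteq> C)")
        case True
        then show ?thesis
          using canonical_copy_exists[OF C, of S \<tau> f g] by (auto simp: Q_def fields Bex_def)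
      next
        case False
        then have "Q ({}, {}) F" by (auto simp: Q_def fields)
        then show ?thesis by blast
      qed
    qed
    show "\<exists>F''. \<forall>b. Q b F'' \<longrightarrow> Q b F \<and> Q b F'" for F F'
    proof -
      obtain S g \<tau> where F: "F = (S, g, \<tau>)" by (cases F)
      obtain S' g' \<tau>' where F': "F' = (S', g', \<tau>')" by (cases F')
      consider "\<not> (finite S \<and> (\<forall>i\<in>S. \<tau> i \<subseteq> C))" | "\<not> (finite S' \<and> (\<forall>i\<in>S'. \<tau>' i \<subseteq> C))"
        | "finite S" "\<forall>i\<in>S. \<tau> i \<subseteq> C" "finite S'" "\<forall>i\<in>S'. \<tau>' i \<subseteq> C" by blast
      then show ?thesis
      proof cases
        case 1
        then have "Q b F" for b by (auto simp: Q_def F split: prod.split)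
        then show ?thesis by blast
      next
        case 2
        then have "Q b F'" for b by (auto simp: Q_def F' split: prod.split)
        then show ?thesis by blast
      next
        case 3
        (* the disjoint union: even numbers for the first graph, odd ones for the second *)
        define T where "T = (\<lambda>i. 2 * i) ` S \<union> (\<lambda>i. 2 * i + 1) ` S'"
        define h where "h e = (if \<forall>k\<in>e. even k then g ((\<lambda>k. k div 2) ` e) else g' ((\<lambda>k. k div 2) ` e))" for e
        define \<sigma> where "\<sigma> i = (if even i then \<tau> (i div 2) else \<tau>' (i div 2))" for i
        have T: "finite T \<and> (\<forall>i\<in>T. \<sigma> i \<subseteq> C)" using 3 by (auto simp: T_def \<sigma>_def)
        have "Q b F \<and> Q b F'" if "Q b (T, h, \<sigma>)" for b
        proof -
          obtain B N where b: "b = (B, N)" by (cases b)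
          have "\<exists>x. canonical f C B N T h \<sigma> x" using that T by (simp add: Q_def b)
          then obtain x where x: "canonical f C B N T h \<sigma> x" ..
          have "canonical f C B N S g \<tau> (x \<circ> (\<lambda>i. 2 * i))"
            by (rule canonical_reindex[OF x]) (auto simp: T_def \<sigma>_def h_def inj_on_def)
          moreover have "canonical f C B N S' g' \<tau>' (x \<circ> (\<lambda>i. 2 * i + 1))"
            by (rule canonical_reindex[OF x]) (auto simp: T_def \<sigma>_def h_def inj_on_def)
          ultimately show ?thesis by (auto simp: Q_def b F F')
        qed
        then show ?thesis by blast
      qed
    qed
  qed
  then show ?thesis by (auto simp: Q_def)
qed

end

section \<open>Self-embeddings act as symmetries\<close>

text \<open>
  Adding it to a graph is switching with respect to the set of vertices that satisfy \<open>\<kappa>\<close>.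
\<close>

definition coboundary :: "(nat \<Rightarrow> bool) \<Rightarrow> nat set \<Rightarrow> bool" where
  "coboundary \<kappa> e \<longleftrightarrow> (\<exists>i\<in>e. \<kappa> i) \<and> (\<exists>i\<in>e. \<not> \<kappa> i)"

lemma coboundary_pair [simp]: "coboundary \<kappa> {i, j} \<longleftrightarrow> \<kappa> i \<noteq> \<kappa> j"
  by (auto simp: coboundary_def)

context random_graph_reduct
begin

definition self_embedding :: "('v \<Rightarrow> 'v) \<Rightarrow> bool" where
  "self_embedding f \<longleftrightarrow> f ` V \<subseteq> V \<and> inj_on f V \<and>
     (\<forall>r xs. \<Sigma> r = Some (length xs) \<longrightarrow> set xs \<subseteq> V \<longrightarrow> (xs \<in> interp A r \<longleftrightarrow> map f xs \<in> interp A r))"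

lemma indist_self_embedding:
  assumes f: "self_embedding f" and "finite S" and x: "realizes S g x" and fx: "realizes S h (f \<circ> x)"
  shows "indist S g h"
proof (rule indistI[OF assms(2) x fx])
  show "agree S x (f \<circ> x)"
    unfolding agree_def
  proof (intro allI impI)
    fix r "is" assume r: "\<Sigma> r = Some (length is)" and "set is \<subseteq> S"
    then have "set (map x is) \<subseteq> V" using x by (auto simp: realizes_def)
    then have "map x is \<in> interp A r \<longleftrightarrow> map f (map x is) \<in> interp A r"
      using f r unfolding self_embedding_def by (metis length_map)
    then show "map x is \<in> interp A r \<longleftrightarrow> map (f \<circ> x) is \<in> interp A r" by simp
  qed
qed

text \<open>
  On a finite index set, switching with respect to a set is the composition of the switchings at its
  elements.
\<close>
lemma coboundary_symmetry:
  assumes "\<And>x. \<kappa> x \<Longrightarrow> (\<lambda>e. x \<in> e) \<in> symmetries"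
  shows "coboundary \<kappa> \<in> symmetries"
proof (rule symmetries_local)
  fix S :: "nat set" assume "finite S"
  have ind: "coboundary (\<lambda>i. i \<in> T) \<in> symmetries" if "finite T" "T \<subseteq> {x. \<kappa> x}" for T
    using that
  proof (induction T)
    case empty
    show ?case by (rule symmetries_cong[OF symmetries_zero]) simp
  next
    case (insert x T)
    have "(\<lambda>e. x \<in> e) \<in> symmetries" by (rule assms) (use insert.prems in simp)
    moreover have "coboundary (\<lambda>i. i \<in> T) \<in> symmetries" by (rule insert.IH) (use insert.prems in simp)
    ultimately have "(\<lambda>e. (x \<in> e) \<noteq> coboundary (\<lambda>i. i \<in> T) e) \<in> symmetries"
      by (rule symmetries_add)
    then show ?case by (rule symmetries_cong) (use insert.hyps in auto)
  qed
  have "coboundary (\<lambda>i. i \<in> {i\<in>S. \<kappa> i}) \<in> symmetries"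
    by (rule ind) (use \<open>finite S\<close> in auto)
  then show "\<exists>d'\<in>symmetries. \<forall>i\<in>S. \<forall>j\<in>S. i \<noteq> j \<longrightarrow> (coboundary \<kappa> {i, j} \<longleftrightarrow> d' {i, j})"
    by (rule bexI[rotated]) simp
qed

lemma all_symmetries:
  assumes "\<And>x y. x \<noteq> y \<Longrightarrow> (\<lambda>e. e = {x, y}) \<in> symmetries"
  shows "d \<in> symmetries"
proof (rule symmetries_local)
  fix S :: "nat set" assume S: "finite S"
  have ind: "(\<lambda>e. e \<in> P) \<in> symmetries"
    if "finite P" "\<And>e. e \<in> P \<Longrightarrow> \<exists>x y. x \<noteq> y \<and> e = {x, y}" for P
    using that
  proof (induction P)
    case empty
    then show ?case using symmetries_zero by simp
  next
    case (insert e P)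
    obtain x y where "x \<noteq> y" "e = {x, y}" using insert.prems by blast
    then have "(\<lambda>e'. e' = e) \<in> symmetries" using assms by simp
    moreover have "(\<lambda>e. e \<in> P) \<in> symmetries" using insert.IH insert.prems by simp
    ultimately have "(\<lambda>e'. (e' = e) \<noteq> (e' \<in> P)) \<in> symmetries" by (rule symmetries_add)
    then show ?case by (rule symmetries_cong) (use insert.hyps in auto)
  qed
  define P where "P = {e \<in> (\<lambda>(i, j). {i, j}) ` {(i, j). i \<in> S \<and> j \<in> S \<and> i \<noteq> j}. d e}"
  have "finite {(i, j). i \<in> S \<and> j \<in> S \<and> i \<noteq> j}"
    by (rule finite_subset[of _ "S \<times> S"]) (use S in auto)
  then have "(\<lambda>e. e \<in> P) \<in> symmetries" by (intro ind) (auto simp: P_def)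
  moreover have "d {i, j} \<longleftrightarrow> {i, j} \<in> P" if "i \<in> S" "j \<in> S" "i \<noteq> j" for i j
    using that by (auto simp: P_def image_iff)
  ultimately show "\<exists>d'\<in>symmetries. \<forall>i\<in>S. \<forall>j\<in>S. i \<noteq> j \<longrightarrow> (d {i, j} \<longleftrightarrow> d' {i, j})"
    by (intro bexI[of _ "\<lambda>e. e \<in> P"] ballI impI)
qed

end

text \<open>
  The situation of the main argument: \<open>f\<close> behaves canonically over \<open>C\<close>, and flipping some edge is
  not a symmetry. The latter yields the contradiction in each of the steps below, in the form
  \<open>no_flips\<close>.
\<close>
locale canonical_self_embedding = random_graph_reduct V E \<Sigma> A
  for V :: "'v set" and E :: "('v \<times> 'v) set" and \<Sigma> :: "'s signature" and A :: "('s, 'v) rel_structure" +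
  fixes f :: "'v \<Rightarrow> 'v" and C :: "'v set" and B :: "('v set set \<times> bool) set" and N :: "('v \<times> 'v set) set"
  assumes f: "self_embedding f"
    and C: "finite C" "C \<subseteq> V"
    and canonical: "\<And>S g \<tau>. finite S \<Longrightarrow> (\<And>i. i \<in> S \<Longrightarrow> \<tau> i \<subseteq> C) \<Longrightarrow> \<exists>x. canonical f C B N S g \<tau> x"
    and flip_not_symmetry: "\<exists>x y. x \<noteq> y \<and> (\<lambda>e. e = {x, y}) \<notin> symmetries"
begin

lemma no_flips:
  assumes "\<And>x y S g. x \<noteq> y \<Longrightarrow> x \<in> S \<Longrightarrow> y \<in> S \<Longrightarrow> finite S \<Longrightarrow> indist S g (\<lambda>e. g e \<noteq> (e = {x, y}))"
  shows False
proof -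
  obtain x y where xy: "x \<noteq> y" "(\<lambda>e. e = {x, y}) \<notin> symmetries" using flip_not_symmetry by blast
  have "indist S g (\<lambda>e. g e \<noteq> (e = {x, y}))" if "finite S" for S g
  proof (cases "x \<in> S \<and> y \<in> S")
    case True
    then show ?thesis using assms xy that by blast
  next
    case False
    then show ?thesis using that by (intro indist_refl) (auto simp: doubleton_eq_iff)
  qed
  then show False using xy by (auto simp: symmetries_def)
qed

text \<open>
  The link between \<open>f\<close> and \<open>A\<close>: place the vertices in \<open>X\<close> at the constants, as told by \<open>p\<close>, and
  the remaining vertices on a canonical copy. Then \<open>g\<close> is the induced graph and \<open>h\<close> the graph
  induced on the image under \<open>f\<close>, and the self-embedding \<open>f\<close> respects the relations of \<open>A\<close>.
\<close>
lemma indist_image: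
  assumes S: "finite S" and X: "X \<subseteq> S" and p: "inj_on p X" "p ` X \<subseteq> C"
    and \<tau>: "\<And>i. i \<in> S \<Longrightarrow> \<tau> i \<subseteq> C"
    and gXT: "\<And>i j. i \<in> X \<Longrightarrow> j \<in> S - X \<Longrightarrow> g {i, j} \<longleftrightarrow> p i \<in> \<tau> j"
    and gXX: "\<And>i j. i \<in> X \<Longrightarrow> j \<in> X \<Longrightarrow> i \<noteq> j \<Longrightarrow> g {i, j} \<longleftrightarrow> (p i, p j) \<in> E"
    and hTT: "\<And>i j. i \<in> S - X \<Longrightarrow> j \<in> S - X \<Longrightarrow> i \<noteq> j \<Longrightarrow> h {i, j} \<longleftrightarrow> (\<tau> ` {i, j}, g {i, j}) \<in> B"
    and hXT: "\<And>i j. i \<in> X \<Longrightarrow> j \<in> S - X \<Longrightarrow> h {i, j} \<longleftrightarrow> (p i, \<tau> j) \<in> N"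
    and hXX: "\<And>i j. i \<in> X \<Longrightarrow> j \<in> X \<Longrightarrow> i \<noteq> j \<Longrightarrow> h {i, j} \<longleftrightarrow> (f (p i), f (p j)) \<in> E"
  shows "indist S g h"
proof -
  obtain x where "canonical f C B N (S - X) g \<tau> x"
    using canonical[of "S - X" \<tau> g] S \<tau> by auto
  then have x: "inj_on x (S - X)" "x ` (S - X) \<subseteq> V - C"
    "\<And>i j. i \<in> S - X \<Longrightarrow> j \<in> S - X \<Longrightarrow> i \<noteq> j \<Longrightarrow> (x i, x j) \<in> E \<longleftrightarrow> g {i, j}"
    "\<And>i c. i \<in> S - X \<Longrightarrow> c \<in> C \<Longrightarrow> (x i, c) \<in> E \<longleftrightarrow> c \<in> \<tau> i"
    "\<And>i j. i \<in> S - X \<Longrightarrow> j \<in> S - X \<Longrightarrow> i \<noteq> j \<Longrightarrow> (f (x i), f (x j)) \<in> E \<longleftrightarrow> (\<tau> ` {i, j}, g {i, j}) \<in> B"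
    "\<And>i c. i \<in> S - X \<Longrightarrow> c \<in> C \<Longrightarrow> (f (x i), f c) \<in> E \<longleftrightarrow> (c, \<tau> i) \<in> N"
    unfolding canonical_def realizes_def by simp_all
  define y where "y i = (if i \<in> X then p i else x i)" for i
  have pC: "p i \<in> C" if "i \<in> X" for i using p(2) that by blast
  have xV: "x i \<in> V - C" if "i \<in> S - X" for i using x(2) that by blast
  have yV: "y i \<in> V" if "i \<in> S" for i
    using pC[of i] xV[of i] that C(2) by (cases "i \<in> X") (auto simp: y_def)
  have y_inj: "inj_on y S"
  proof (rule inj_onI)
    fix i j assume ij: "i \<in> S" "j \<in> S" "y i = y j"
    show "i = j"
    proof (cases "i \<in> X"; cases "j \<in> X")
      assume "i \<in> X" "j \<in> X"
      then show ?thesis using ij p(1) by (simp add: y_def inj_on_def)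
    next
      assume "i \<in> X" "j \<notin> X"
      then show ?thesis using ij pC[of i] xV[of j] by (simp add: y_def)
    next
      assume "i \<notin> X" "j \<in> X"
      then show ?thesis using ij pC[of j] xV[of i] by (simp add: y_def)
    next
      assume "i \<notin> X" "j \<notin> X"
      then show ?thesis using ij x(1) by (simp add: y_def inj_on_def)
    qed
  qed
  have pairs: "((y i, y j) \<in> E \<longleftrightarrow> g {i, j}) \<and> ((f (y i), f (y j)) \<in> E \<longleftrightarrow> h {i, j})"
    if ij: "i \<in> S" "j \<in> S" "i \<noteq> j" for i j
  proof (cases "i \<in> X"; cases "j \<in> X")
    assume "i \<in> X" "j \<in> X"
    then show ?thesis using ij gXX hXX by (simp add: y_def)
  next
    assume X: "i \<in> X" "j \<notin> X"
    then show ?thesis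
      using ij gXT[of i j] hXT[of i j] x(4)[of j "p i"] x(6)[of j "p i"] pC[of i]
        sym_E[of "p i" "x j"] sym_E[of "f (p i)" "f (x j)"] by (simp add: y_def)
  next
    assume X: "i \<notin> X" "j \<in> X"
    then show ?thesis
      using ij gXT[of j i] hXT[of j i] x(4)[of i "p j"] x(6)[of i "p j"] pC[of j]
      by (simp add: y_def insert_commute)
  next
    assume X: "i \<notin> X" "j \<notin> X"
    then show ?thesis using ij x(3)[of i j] x(5)[of i j] hTT[of i j] by (simp add: y_def)
  qed
  have "realizes S g y" using y_inj yV pairs by (auto simp: realizes_def)
  moreover have "realizes S h (f \<circ> y)"
  proof -
    have "inj_on (f \<circ> y) S"
      using f y_inj yV by (intro comp_inj_on) (auto simp: self_embedding_def intro: inj_on_subset)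
    moreover have "f (y i) \<in> V" if "i \<in> S" for i using f yV[OF that] by (auto simp: self_embedding_def)
    ultimately show ?thesis using pairs by (auto simp: realizes_def)
  qed
  ultimately show ?thesis by (rule indist_self_embedding[OF f S])
qed

lemma indist_image_typed:
  assumes "finite S" "\<And>i. i \<in> S \<Longrightarrow> \<tau> i \<subseteq> C"
    and "\<And>i j. i \<in> S \<Longrightarrow> j \<in> S \<Longrightarrow> i \<noteq> j \<Longrightarrow> h {i, j} \<longleftrightarrow> (\<tau> ` {i, j}, g {i, j}) \<in> B"
  shows "indist S g h"
  by (rule indist_image[of S "{}" undefined \<tau>]) (use assms in auto)

text \<open>
  Give \<open>x\<close> type \<open>t\<close> and all other vertices type \<open>t'\<close>. If the edges between these types had the same
  image in both states, then flipping \<open>{x, y}\<close> in an arbitrary graph would not change its image.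
\<close>
lemma B_injective:
  assumes t: "t \<subseteq> C" "t' \<subseteq> C"
  shows "({t, t'}, True) \<in> B \<longleftrightarrow> ({t, t'}, False) \<notin> B"
proof (rule ccontr)
  assume "\<not> ?thesis"
  then have const: "({t, t'}, b) \<in> B \<longleftrightarrow> ({t, t'}, b') \<in> B" for b b'
    by (cases b; cases b') auto
  show False
  proof (rule no_flips)
    fix x y :: nat and S g assume xy: "x \<noteq> y" "x \<in> S" "y \<in> S" and S: "finite S"
    define \<tau> where "\<tau> = (\<lambda>_. t')(x := t)"
    define h where "h e \<longleftrightarrow> (\<tau> ` e, g e) \<in> B" for e
    have \<tau>: "\<tau> i \<subseteq> C" for i using t by (simp add: \<tau>_def)
    have "\<tau> ` {x, y} = {t, t'}" using xy by (auto simp: \<tau>_def)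
    then have "h e \<longleftrightarrow> (\<tau> ` e, g e \<noteq> (e = {x, y})) \<in> B" for e
      using const[of "g e"] by (cases "e = {x, y}") (auto simp: h_def)
    then have "indist S (\<lambda>e. g e \<noteq> (e = {x, y})) h"
      using S \<tau> by (intro indist_image_typed[of S \<tau>]) blast+
    moreover have "indist S g h"
      using S \<tau> h_def by (intro indist_image_typed[of S \<tau>]) blast+
    ultimately show "indist S g (\<lambda>e. g e \<noteq> (e = {x, y}))"
      using indist_sym indist_trans[OF S] by blast
  qed
qed

text \<open>
  Between types \<open>t\<close> and \<open>t'\<close>, \<open>f\<close> either keeps all edges or exchanges edges and non-edges; \<open>shift\<close>
  holds in the second case.
\<close>
definition shift :: "'v set \<Rightarrow> 'v set \<Rightarrow> bool" where
  "shift t t' \<longleftrightarrow> ({t, t'}, False) \<in> B"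

lemma shift_sym: "shift t t' = shift t' t"
  by (simp add: shift_def insert_commute)

lemma B_shift: "t \<subseteq> C \<Longrightarrow> t' \<subseteq> C \<Longrightarrow> ({t, t'}, b) \<in> B \<longleftrightarrow> b \<noteq> shift t t'"
  using B_injective[of t t'] by (cases b) (auto simp: shift_def)

lemma typed_symmetry:
  assumes "\<And>i. \<tau> i \<subseteq> C"
  shows "(\<lambda>e. (\<tau> ` e, False) \<in> B) \<in> symmetries"
  unfolding symmetries_def
  by (intro CollectI allI impI, rule indist_image_typed[of _ \<tau>])
    (use assms in \<open>auto simp: B_shift\<close>)

text \<open>
  Assigning types to the vertices of an arbitrary graph yields a symmetry. Take four such
  assignments, where only \<open>x\<close> and \<open>y\<close> may have a type other than \<open>t\<close>: \<open>x\<close> gets \<open>t1\<close> or \<open>t\<close>, and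
  \<open>y\<close> gets \<open>t2\<close> or \<open>t\<close>. In the sum of the four symmetries all contributions cancel except those to
  the edge \<open>{x, y}\<close>, where the sum is the exclusive or of the four values of \<open>shift\<close>.
\<close>
lemma shift_cocycle:
  assumes t: "t \<subseteq> C" "t1 \<subseteq> C" "t2 \<subseteq> C"
  shows "(shift t1 t2 \<noteq> shift t1 t) = (shift t t2 \<noteq> shift t t)"
proof (rule ccontr)
  assume neg: "\<not> ?thesis"
  obtain x y :: nat where xy: "x \<noteq> y" "(\<lambda>e. e = {x, y}) \<notin> symmetries" using flip_not_symmetry by blast
  define D where "D u u' e \<longleftrightarrow> (((\<lambda>_. t)(x := u, y := u')) ` e, False) \<in> B" for u u' e
  have D: "D u u' \<in> symmetries" if "u \<subseteq> C" "u' \<subseteq> C" for u u'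
    unfolding D_def by (rule typed_symmetry) (use that t in simp)
  have val: "D u u' {i, j} \<longleftrightarrow> shift (if i = y then u' else if i = x then u else t)
      (if j = y then u' else if j = x then u else t)" for u u' i j
    by (simp only: D_def shift_def image_insert image_empty fun_upd_apply)
  have "(\<lambda>e. (D t1 t2 e \<noteq> D t1 t e) \<noteq> (D t t2 e \<noteq> D t t e)) \<in> symmetries"
    by (rule symmetries_add[OF symmetries_add[OF D D] symmetries_add[OF D D]]) (rule t)+
  then have "(\<lambda>e. e = {x, y}) \<in> symmetries"
  proof (rule symmetries_cong)
    fix i j :: nat assume "i \<noteq> j"
    then consider "i = x" "j = y" | "i = y" "j = x" | "i \<noteq> x" "j \<noteq> x" | "i \<noteq> y" "j \<noteq> y"
      using xy(1) by blast
    then show "(D t1 t2 {i, j} \<noteq> D t1 t {i, j}) \<noteq> (D t t2 {i, j} \<noteq> D t t {i, j}) \<longleftrightarrow> {i, j} = {x, y}"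
    proof cases
      case 1
      then have "D u u' {i, j} = shift u u'" for u u' using xy(1) by (simp add: val)
      moreover have "{i, j} = {x, y}" using 1 by simp
      ultimately show ?thesis using neg by blast
    next
      case 2
      then have "D u u' {i, j} = shift u u'" for u u' using xy(1) by (simp add: val shift_sym[of u'])
      moreover have "{i, j} = {x, y}" using 2 by blast
      ultimately show ?thesis using neg by blast
    next
      case 3
      then have "{i, j} \<noteq> {x, y}" by (simp add: doubleton_eq_iff)
      then show ?thesis using 3 by (simp add: val)
    next
      case 4
      then have "{i, j} \<noteq> {x, y}" by (simp add: doubleton_eq_iff)
      then show ?thesis using 4 by (simp add: val)
    qed
  qed
  then show False using xy by simp
qed

text \<open>
  With respect to the empty type as base point, \<open>shift_cocycle\<close> says that \<open>f\<close> acts as the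
  switching given by \<open>\<sigma>\<close>, followed by complementation if \<open>s0\<close> holds (\<open>shift_eq\<close>).
\<close>
definition s0 :: bool where "s0 = shift {} {}"

definition \<sigma> :: "'v set \<Rightarrow> bool" where "\<sigma> t \<longleftrightarrow> shift t {} \<noteq> s0"

lemma shift_eq:
  assumes "t \<subseteq> C" "t' \<subseteq> C"
  shows "shift t t' \<longleftrightarrow> (\<sigma> t \<noteq> \<sigma> t') \<noteq> s0"
  using shift_cocycle[of "{}" t t'] assms shift_sym[of "{}" t'] by (auto simp: \<sigma>_def s0_def)

lemma constant_symmetry: "(\<lambda>_. s0) \<in> symmetries"
  by (rule symmetries_cong[OF typed_symmetry[of "\<lambda>_. {}"]]) (auto simp: s0_def shift_def)

lemma star_symmetry_if_\<sigma>:
  assumes "\<sigma> t" "t \<subseteq> C"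
  shows "(\<lambda>e. x \<in> e) \<in> symmetries"
proof -
  let ?\<tau> = "(\<lambda>_. {})(x := t)"
  have \<tau>: "?\<tau> i \<subseteq> C" for i using assms by simp
  have "(\<lambda>e. ((?\<tau> ` e, False) \<in> B) \<noteq> s0) \<in> symmetries"
    using typed_symmetry[OF \<tau>] constant_symmetry by (rule symmetries_add)
  then show ?thesis
  proof (rule symmetries_cong)
    fix i j :: nat assume "i \<noteq> j"
    have "(?\<tau> ` {i, j}, False) \<in> B \<longleftrightarrow> shift (?\<tau> i) (?\<tau> j)" by (simp only: shift_def image_insert image_empty)
    also have "\<dots> \<longleftrightarrow> (\<sigma> (?\<tau> i) \<noteq> \<sigma> (?\<tau> j)) \<noteq> s0" using \<tau> by (intro shift_eq)
    finally show "((?\<tau> ` {i, j}, False) \<in> B) \<noteq> s0 \<longleftrightarrow> x \<in> {i, j}"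
      using \<open>i \<noteq> j\<close> assms(1) by (auto simp: \<sigma>_def s0_def)
  qed
qed

text \<open>
  Whether \<open>c\<close> is adjacent to a vertex of type \<open>t\<close> in the image of \<open>f\<close>, after the switching and
  complementation found on the vertices outside \<open>C\<close> have been undone.
\<close>
definition \<nu> :: "'v \<Rightarrow> 'v set \<Rightarrow> bool" where
  "\<nu> c t \<longleftrightarrow> (((c, t) \<in> N) \<noteq> \<sigma> t) \<noteq> s0"

text \<open>
  The image of \<open>f\<close> may be corrected by symmetries, namely by the switching \<open>\<sigma>\<close> and by \<open>s0\<close>. After
  this, \<open>f\<close> acts as the identity on the vertices outside \<open>C\<close>.
\<close>
lemma indist_normalised:
  assumes S: "finite S" and X: "X \<subseteq> S" and p: "inj_on p X" "p ` X \<subseteq> C"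
    and \<tau>: "\<And>i. i \<in> S \<Longrightarrow> \<tau> i \<subseteq> C"
    and gXT: "\<And>i j. i \<in> X \<Longrightarrow> j \<in> S - X \<Longrightarrow> g {i, j} \<longleftrightarrow> p i \<in> \<tau> j"
    and gXX: "\<And>i j. i \<in> X \<Longrightarrow> j \<in> X \<Longrightarrow> i \<noteq> j \<Longrightarrow> g {i, j} \<longleftrightarrow> (p i, p j) \<in> E"
    and hTT: "\<And>i j. i \<in> S - X \<Longrightarrow> j \<in> S - X \<Longrightarrow> i \<noteq> j \<Longrightarrow> h {i, j} \<longleftrightarrow> g {i, j}"
    and hXT: "\<And>i j. i \<in> X \<Longrightarrow> j \<in> S - X \<Longrightarrow> h {i, j} \<longleftrightarrow> \<nu> (p i) (\<tau> j)"
    and hXX: "\<And>i j. i \<in> X \<Longrightarrow> j \<in> X \<Longrightarrow> i \<noteq> j \<Longrightarrow> h {i, j} \<longleftrightarrow> ((f (p i), f (p j)) \<in> E) \<noteq> s0"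
  shows "indist S g h"
proof -
  define \<kappa> where "\<kappa> i \<longleftrightarrow> i \<in> S - X \<and> \<sigma> (\<tau> i)" for i
  define d where "d e \<longleftrightarrow> coboundary \<kappa> e \<noteq> s0" for e
  have "coboundary \<kappa> \<in> symmetries"
    by (rule coboundary_symmetry) (use \<tau> star_symmetry_if_\<sigma> in \<open>auto simp: \<kappa>_def\<close>)
  then have d: "d \<in> symmetries"
    unfolding d_def using constant_symmetry by (rule symmetries_add)
  let ?h = "\<lambda>e. h e \<noteq> d e"
  have "indist S g ?h"
  proof (rule indist_image[OF S X p \<tau> gXT gXX])
    fix i j assume ij: "i \<in> S - X" "j \<in> S - X" "i \<noteq> j"
    have "(\<tau> ` {i, j}, g {i, j}) \<in> B \<longleftrightarrow> g {i, j} \<noteq> ((\<sigma> (\<tau> i) \<noteq> \<sigma> (\<tau> j)) \<noteq> s0)"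
      using ij \<tau> by (simp add: B_shift shift_eq)
    then show "?h {i, j} \<longleftrightarrow> (\<tau> ` {i, j}, g {i, j}) \<in> B"
      using ij hTT[OF ij] by (simp add: d_def \<kappa>_def)
  next
    fix i j assume ij: "i \<in> X" "j \<in> S - X"
    then show "?h {i, j} \<longleftrightarrow> (p i, \<tau> j) \<in> N"
      using hXT[OF ij] by (auto simp: d_def \<kappa>_def \<nu>_def)
  next
    fix i j assume ij: "i \<in> X" "j \<in> X" "i \<noteq> j"
    then show "?h {i, j} \<longleftrightarrow> (f (p i), f (p j)) \<in> E"
      using hXX[OF ij] by (auto simp: d_def \<kappa>_def)
  qed
  moreover have "indist S h ?h" using symmetriesD[OF d S] .
  ultimately show ?thesis using indist_sym indist_trans[OF S] by blast
qed

text \<open>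
  Place \<open>x\<close> at the constant \<open>c\<close> and let \<open>y\<close> have type \<open>t\<close> or \<open>t'\<close>, according to whether it is
  adjacent to \<open>x\<close>. If \<open>\<nu>\<close> did not separate the two types, then flipping \<open>{x, y}\<close> in an arbitrary
  graph would not change the normalised image.
\<close>
lemma \<nu>_injective:
  assumes c: "c \<in> C" and t: "t \<subseteq> C" "t' \<subseteq> C" "c \<in> t" "c \<notin> t'"
  shows "\<nu> c t \<noteq> \<nu> c t'"
proof
  assume eq: "\<nu> c t = \<nu> c t'"
  show False
  proof (rule no_flips)
    fix x y :: nat and S g assume xy: "x \<noteq> y" "x \<in> S" "y \<in> S" and S: "finite S"
    define \<tau> where "\<tau> g z = (if z = y then if g {x, y} then t else t' else if g {x, z} then {c} else {})"
      for g :: "nat set \<Rightarrow> bool" and z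
    define h where "h e \<longleftrightarrow> (if x \<in> e then \<exists>z\<in>e. z \<noteq> x \<and> \<nu> c (\<tau> g z) else g e)" for e
    let ?g = "\<lambda>e. g e \<noteq> (e = {x, y})"
    have img: "indist S g' h" if g': "g' = g \<or> g' = ?g" for g'
    proof (rule indist_normalised[OF S, of "{x}" "\<lambda>_. c" "\<tau> g'"])
      fix i j assume ij: "i \<in> S - {x}" "j \<in> S - {x}" "i \<noteq> j"
      then show "h {i, j} \<longleftrightarrow> g' {i, j}" using g' by (auto simp: h_def doubleton_eq_iff)
    next
      fix i j assume ij: "i \<in> {x}" "j \<in> S - {x}"
      then have "h {i, j} \<longleftrightarrow> \<nu> c (\<tau> g j)" by (auto simp: h_def)
      also have "\<dots> \<longleftrightarrow> \<nu> c (\<tau> g' j)"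
        using g' eq ij by (auto simp: \<tau>_def doubleton_eq_iff)
      finally show "h {i, j} \<longleftrightarrow> \<nu> c (\<tau> g' j)" .
    qed (use xy c t in \<open>auto simp: \<tau>_def\<close>)
    show "indist S g ?g"
      using img[of g] img[of ?g] indist_sym indist_trans[OF S] by blast
  qed
qed

text \<open>
  The constants at which \<open>f\<close> switches, after normalisation.
\<close>
definition \<rho> :: "'v \<Rightarrow> bool" where "\<rho> c = \<nu> c {}"

text \<open>
  The values of \<open>\<nu> c\<close> at types that contain \<open>c\<close> differ from those at types that do not, so \<open>\<nu> c\<close>
  depends only on whether \<open>c\<close> is in the type. The types \<open>{}\<close> and \<open>C\<close> serve for comparison.
\<close>
lemma \<nu>_eq:
  assumes "c \<in> C" "t \<subseteq> C"
  shows "\<nu> c t \<longleftrightarrow> (c \<in> t) \<noteq> \<rho> c"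
proof (cases "c \<in> t")
  case True
  then show ?thesis using \<nu>_injective[of c t "{}"] assms by (auto simp: \<rho>_def)
next
  case False
  then show ?thesis using \<nu>_injective[of c C t] \<nu>_injective[of c C "{}"] assms by (auto simp: \<rho>_def)
qed

text \<open>
  An arbitrary graph with \<open>x\<close> placed at \<open>c\<close> has as its normalised image the graph switched at \<open>x\<close>.
\<close>
lemma star_symmetry_if_\<rho>:
  assumes c: "c \<in> C" and "\<rho> c"
  shows "(\<lambda>e. x \<in> e) \<in> symmetries"
  unfolding symmetries_def
proof (intro CollectI allI impI)
  fix S :: "nat set" and g assume S: "finite S"
  show "indist S g (\<lambda>e. g e \<noteq> (x \<in> e))"
  proof (cases "x \<in> S")
    case False
    then show ?thesis by (intro indist_refl S) auto
  next
    case True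
    show ?thesis
      by (rule indist_normalised[OF S, of "{x}" "\<lambda>_. c" "\<lambda>z. if g {x, z} then {c} else {}"])
        (use True assms in \<open>auto simp: \<nu>_eq\<close>)
  qed
qed

text \<open>
  Place \<open>x\<close> and \<open>y\<close> at \<open>c\<close> and \<open>c'\<close>. All edges except \<open>{x, y}\<close> are known to be preserved up to
  symmetries, so a wrong value at \<open>{x, y}\<close> would turn a flip of this edge into a symmetry. This works
  for graphs that agree with \<open>E\<close> on the pair; other graphs are obtained from these by a flip.
\<close>
lemma constants_twisted:
  assumes c: "c \<in> C" "c' \<in> C" "c \<noteq> c'"
  shows "(f c, f c') \<in> E \<longleftrightarrow> ((c, c') \<in> E) \<noteq> ((\<rho> c \<noteq> \<rho> c') \<noteq> s0)"
proof (rule ccontr)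
  assume neg: "\<not> ?thesis"
  show False
  proof (rule no_flips)
    fix x y :: nat and S g assume xy: "x \<noteq> y" "x \<in> S" "y \<in> S" and S: "finite S"
    have flip: "indist S g (\<lambda>e. g e \<noteq> (e = {x, y}))" if gxy: "g {x, y} \<longleftrightarrow> (c, c') \<in> E" for g
    proof -
      define \<kappa> where "\<kappa> i \<longleftrightarrow> i = x \<and> \<rho> c \<or> i = y \<and> \<rho> c'" for i
      have \<kappa>: "coboundary \<kappa> \<in> symmetries"
        by (rule coboundary_symmetry) (use c star_symmetry_if_\<rho> in \<open>auto simp: \<kappa>_def\<close>)
      let ?h = "\<lambda>e. g e \<noteq> (e = {x, y})"
      define \<tau> where "\<tau> z = (if g {x, z} then {c} else {}) \<union> (if g {y, z} then {c'} else {})" for z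
      have \<tau>: "\<tau> z \<subseteq> C" "c \<in> \<tau> z \<longleftrightarrow> g {x, z}" "c' \<in> \<tau> z \<longleftrightarrow> g {y, z}" for z
        using c by (auto simp: \<tau>_def)
      have "indist S g (\<lambda>e. ?h e \<noteq> coboundary \<kappa> e)"
      proof (rule indist_normalised[OF S, of "{x, y}" "(\<lambda>_. c')(x := c)" \<tau>])
        fix i j assume ij: "i \<in> {x, y}" "j \<in> {x, y}" "i \<noteq> j"
        then have ij': "i = x \<and> j = y \<or> i = y \<and> j = x" by auto
        then show "?h {i, j} \<noteq> coboundary \<kappa> {i, j} \<longleftrightarrow>
          ((f (((\<lambda>_. c')(x := c)) i), f (((\<lambda>_. c')(x := c)) j)) \<in> E) \<noteq> s0"
          using neg gxy xy by (auto simp: \<kappa>_def insert_commute sym_E[of "f c'" "f c"])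
        show "g {i, j} \<longleftrightarrow> (((\<lambda>_. c')(x := c)) i, ((\<lambda>_. c')(x := c)) j) \<in> E"
          using ij' gxy xy by (auto simp: insert_commute sym_E[of c' c])
      qed (use xy c \<tau> in \<open>auto simp: \<nu>_eq \<kappa>_def doubleton_eq_iff inj_on_def\<close>)
      moreover have "indist S ?h (\<lambda>e. ?h e \<noteq> coboundary \<kappa> e)" by (rule symmetriesD[OF \<kappa> S])
      ultimately show ?thesis using indist_sym indist_trans[OF S] by blast
    qed
    show "indist S g (\<lambda>e. g e \<noteq> (e = {x, y}))"
    proof (cases "g {x, y} \<longleftrightarrow> (c, c') \<in> E")
      case True
      then show ?thesis by (rule flip)
    next
      case False
      then have "indist S (\<lambda>e. g e \<noteq> (e = {x, y})) (\<lambda>e. (g e \<noteq> (e = {x, y})) \<noteq> (e = {x, y}))"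
        by (intro flip) auto
      moreover have "(\<lambda>e. (g e \<noteq> (e = {x, y})) \<noteq> (e = {x, y})) = g" by auto
      ultimately show ?thesis using indist_sym by simp
    qed
  qed
qed

lemma twisted_on_constants:
  assumes "inj_on a T" "a ` T \<subseteq> C"
  shows "\<exists>d\<in>symmetries. twist d T a (f \<circ> a)"
proof
  let ?\<kappa> = "\<lambda>i. i \<in> T \<and> \<rho> (a i)"
  have "coboundary ?\<kappa> \<in> symmetries"
    by (rule coboundary_symmetry) (use assms star_symmetry_if_\<rho> in blast)
  then show "(\<lambda>e. coboundary ?\<kappa> e \<noteq> s0) \<in> symmetries"
    using constant_symmetry by (rule symmetries_add)
  have aC: "a i \<in> C" if "i \<in> T" for i using assms(2) that by blast
  have fV: "f (a i) \<in> V" if "i \<in> T" for i using aC[OF that] C(2) f by (auto simp: self_embedding_def)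
  have "inj_on (f \<circ> a) T"
    using f assms C(2) by (intro comp_inj_on) (auto simp: self_embedding_def intro: inj_on_subset)
  moreover have "(f (a i), f (a j)) \<in> E \<longleftrightarrow> ((a i, a j) \<in> E) \<noteq> (coboundary ?\<kappa> {i, j} \<noteq> s0)"
    if "i \<in> T" "j \<in> T" "i \<noteq> j" for i j
    using that aC constants_twisted[of "a i" "a j"] assms(1) by (simp add: inj_on_eq_iff)
  ultimately show "twist (\<lambda>e. coboundary ?\<kappa> e \<noteq> s0) T a (f \<circ> a)"
    using assms C(2) fV by (auto simp: twist_def)
qed

end

context random_graph_reduct
begin

theorem self_embedding_twist:
  assumes f: "self_embedding f" and T: "finite T" and a: "inj_on a T" "a ` T \<subseteq> V"
  shows "\<exists>d\<in>symmetries. twist d T a (f \<circ> a)"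
proof (cases "\<exists>x y. x \<noteq> y \<and> (\<lambda>e. e = {x, y}) \<notin> symmetries")
  case True
  have aT: "finite (a ` T)" using T by simp
  obtain B N where BN: "\<And>S g \<tau>. finite S \<and> (\<forall>i\<in>S. \<tau> i \<subseteq> a ` T) \<longrightarrow> (\<exists>x. canonical f (a ` T) B N S g \<tau> x)"
    using canonical_behaviour[OF aT a(2), of f] by blast
  interpret canonical_self_embedding V E \<Sigma> A f "a ` T" B N
    by unfold_locales (use f aT a BN True in auto)
  show ?thesis using twisted_on_constants a(1) by blast
next
  case False
  then have all: "d \<in> symmetries" for d using all_symmetries by blast
  have "f (a i) \<in> V" if "i \<in> T" for i using f a(2) that by (auto simp: self_embedding_def)
  moreover have "inj_on (f \<circ> a) T"
    using f a by (intro comp_inj_on) (auto simp: self_embedding_def intro: inj_on_subset)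
  ultimately have "twist (\<lambda>e. graph_of T a e \<noteq> graph_of T (f \<circ> a) e) T a (f \<circ> a)"
    using a by (auto simp: twist_def graph_of_pair)
  then show ?thesis using all by blast
qed

end

section \<open>Existential definability\<close>

text \<open>
  The two negated cases stand for inequalities and negated atoms, and the sixth one for disjunction.
  Formulas built by these rules need not be in prenex form.
\<close>

inductive existential :: "'s form \<Rightarrow> bool" where
  "existential (Equal x y)"
| "existential (Neg (Equal x y))"
| "existential (Rel r xs)"
| "existential (Neg (Rel r xs))"
| "existential \<phi> \<Longrightarrow> existential \<psi> \<Longrightarrow> existential (Conj \<phi> \<psi>)"
| "existential \<phi> \<Longrightarrow> existential \<psi> \<Longrightarrow> existential (Neg (Conj (Neg \<phi>) (Neg \<psi>)))"
| "existential \<phi> \<Longrightarrow> existential (Exists x \<phi>)"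

lemma existential_preserved:
  assumes h: "embedding \<Sigma> M N h"
  shows "existential \<psi> \<Longrightarrow> wf_form \<Sigma> \<psi> \<Longrightarrow> e \<in> UNIV \<rightarrow> carrier M \<Longrightarrow> sat M e \<psi> \<Longrightarrow> sat N (h \<circ> e) \<psi>"
proof (induction arbitrary: e rule: existential.induct)
  case (2 x y)
  then show ?case using h by (auto simp: embedding_def inj_on_def Pi_iff)
next
  case (3 r xs)
  then have "map e xs \<in> tuples (length xs) (carrier M)" by (auto simp: tuples_def)
  then have "map e xs \<in> interp M r \<longleftrightarrow> map h (map e xs) \<in> interp N r"
    using h 3(1) by (auto simp: embedding_def)
  then show ?case using 3 by (simp add: comp_def)
next
  case (4 r xs)
  then have "map e xs \<in> tuples (length xs) (carrier M)" by (auto simp: tuples_def)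
  then have "map e xs \<in> interp M r \<longleftrightarrow> map h (map e xs) \<in> interp N r"
    using h 4(1) by (auto simp: embedding_def)
  then show ?case using 4 by (simp add: comp_def)
next
  case (7 \<phi> x)
  then obtain a where a: "a \<in> carrier M" "sat M (e(x := a)) \<phi>" by auto
  have "wf_form \<Sigma> \<phi>" "e(x := a) \<in> UNIV \<rightarrow> carrier M" using 7 a(1) by auto
  then have "sat N (h \<circ> e(x := a)) \<phi>" using a(2) by (rule 7(2))
  moreover have "h \<circ> e(x := a) = (h \<circ> e)(x := h a)" by auto
  moreover have "h a \<in> carrier N" using h a by (auto simp: embedding_def)
  ultimately show ?case unfolding sat.simps by metis
qed (auto simp: comp_def)

text \<open>
  Assignments need not be injective; choosing one index per value makes \<open>sat_symmetry\<close>
  applicable to them.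
\<close>
lemma env_index_representatives:
  fixes e :: "nat \<Rightarrow> 'a"
  obtains k where "inj_on e (k ` {..<n})" "\<And>i. i < n \<Longrightarrow> k i < n \<and> e (k i) = e i"
proof
  define k where "k i = (LEAST j. e j = e i)" for i
  have k: "e (k i) = e i" "k i \<le> i" for i
    unfolding k_def by (auto intro: LeastI Least_le)
  show "k i < n \<and> e (k i) = e i" if "i < n" for i using k[of i] that by simp
  show "inj_on e (k ` {..<n})"
  proof (rule inj_onI)
    fix u v assume "u \<in> k ` {..<n}" "v \<in> k ` {..<n}" "e u = e v"
    then obtain i j where ij: "u = k i" "v = k j" "e i = e j" using k by auto
    then show "u = v" by (simp add: k_def)
  qed
qed

context random_graph_reduct
begin

lemma sat_env_symmetry:
  assumes \<phi>: "wf_form \<Sigma> \<phi>" "free_vars \<phi> \<subseteq> {..<n}"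
    and eq: "\<And>i j. i < n \<Longrightarrow> j < n \<Longrightarrow> e i = e j \<Longrightarrow> e' i = e' j"
    and tw: "\<And>T. T \<subseteq> {..<n} \<Longrightarrow> inj_on e T \<Longrightarrow> \<exists>d\<in>symmetries. twist d T e e'"
  shows "sat A e \<phi> \<longleftrightarrow> sat A e' \<phi>"
proof -
  obtain k where k: "inj_on e (k ` {..<n})" "\<And>i. i < n \<Longrightarrow> k i < n \<and> e (k i) = e i"
    using env_index_representatives by blast
  then obtain d where d: "d \<in> symmetries" "twist d (k ` {..<n}) e e'"
    using tw[of "k ` {..<n}"] by auto
  have "sat A (e \<circ> k) \<phi> \<longleftrightarrow> sat A (e' \<circ> k) \<phi>"
    by (rule sat_symmetry[OF d]) (use \<phi> in auto)
  moreover have "sat A (e \<circ> k) \<phi> \<longleftrightarrow> sat A e \<phi>"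
    by (rule sat_cong) (use k \<phi> in auto)
  moreover have "sat A (e' \<circ> k) \<phi> \<longleftrightarrow> sat A e' \<phi>"
    by (rule sat_cong) (use k \<phi> eq in auto)
  ultimately show ?thesis by simp
qed

definition graph_type :: "nat \<Rightarrow> (nat \<Rightarrow> 'v) \<Rightarrow> (nat \<times> nat) set \<times> (nat \<times> nat) set" where
  "graph_type n e = ({(i, j). i < n \<and> j < n \<and> e i = e j}, {(i, j). i < n \<and> j < n \<and> (e i, e j) \<in> E})"

lemma sat_graph_type:
  assumes \<phi>: "wf_form \<Sigma> \<phi>" "free_vars \<phi> \<subseteq> {..<n}"
    and e: "e \<in> UNIV \<rightarrow> V" "e' \<in> UNIV \<rightarrow> V" and t: "graph_type n e = graph_type n e'"
  shows "sat A e \<phi> \<longleftrightarrow> sat A e' \<phi>"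
proof (rule sat_env_symmetry[OF \<phi>])
  have eq: "e i = e j \<longleftrightarrow> e' i = e' j" and E: "(e i, e j) \<in> E \<longleftrightarrow> (e' i, e' j) \<in> E"
    if "i < n" "j < n" for i j
    using t that by (auto simp: graph_type_def set_eq_iff)
  show "e' i = e' j" if "i < n" "j < n" "e i = e j" for i j using eq that by blast
  fix T assume T: "T \<subseteq> {..<n}" and inj: "inj_on e T"
  have "i < n" if "i \<in> T" for i using T that by blast
  then have "twist (\<lambda>_. False) T e e'"
    using inj e eq E by (auto simp: twist_def inj_on_def)
  then show "\<exists>d\<in>symmetries. twist d T e e'" using symmetries_zero by blast
qed

lemma finite_representatives:
  assumes "X \<subseteq> UNIV \<rightarrow> V"
  obtains R where "finite R" "R \<subseteq> X" "\<And>e. e \<in> X \<Longrightarrow> \<exists>e'\<in>R. graph_type n e = graph_type n e'"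
proof -
  have "graph_type n ` X \<subseteq> Pow ({..<n} \<times> {..<n}) \<times> Pow ({..<n} \<times> {..<n})"
    by (auto simp: graph_type_def)
  then have "finite (graph_type n ` X)" by (rule finite_subset) simp
  then obtain R where R: "R \<subseteq> X" "finite R" "graph_type n ` X = graph_type n ` R"
    by (meson finite_subset_image subset_refl)
  have "\<exists>e'\<in>R. graph_type n e = graph_type n e'" if "e \<in> X" for e
    using R(3) that by (metis image_iff)
  then show ?thesis using that R by blast
qed

definition existential_formulas :: "nat \<Rightarrow> 's form set" where
  "existential_formulas n = {\<psi>. existential \<psi> \<and> wf_form \<Sigma> \<psi> \<and> free_vars \<psi> \<subseteq> {..<n}}"

lemma finite_conjunction:
  assumes "finite F" "F \<subseteq> existential_formulas n" "n > 0"
  shows "\<exists>\<psi>\<in>existential_formulas n. \<forall>e. sat A e \<psi> \<longleftrightarrow> (\<forall>\<chi>\<in>F. sat A e \<chi>)"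
  using assms(1,2)
proof (induction F)
  case empty
  have "Equal 0 0 \<in> existential_formulas n"
    using assms(3) by (auto simp: existential_formulas_def intro: existential.intros)
  then show ?case by (rule bexI[rotated]) simp
next
  case (insert \<chi> F)
  then obtain \<psi> where \<psi>: "\<psi> \<in> existential_formulas n" "\<And>e. sat A e \<psi> \<longleftrightarrow> (\<forall>\<chi>\<in>F. sat A e \<chi>)"
    by auto
  have "Conj \<chi> \<psi> \<in> existential_formulas n"
    using \<psi>(1) insert.prems by (auto simp: existential_formulas_def intro: existential.intros)
  then show ?case by (rule bexI[rotated]) (simp add: \<psi>(2))
qed

lemma finite_disjunction:
  assumes "finite F" "F \<subseteq> existential_formulas n" "n > 0"
  shows "\<exists>\<psi>\<in>existential_formulas n. \<forall>e. sat A e \<psi> \<longleftrightarrow> (\<exists>\<chi>\<in>F. sat A e \<chi>)"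
  using assms(1,2)
proof (induction F)
  case empty
  have "Neg (Equal 0 0) \<in> existential_formulas n"
    using assms(3) by (auto simp: existential_formulas_def intro: existential.intros)
  then show ?case by (rule bexI[rotated]) simp
next
  case (insert \<chi> F)
  then obtain \<psi> where \<psi>: "\<psi> \<in> existential_formulas n" "\<And>e. sat A e \<psi> \<longleftrightarrow> (\<exists>\<chi>\<in>F. sat A e \<chi>)"
    by auto
  have "Neg (Conj (Neg \<chi>) (Neg \<psi>)) \<in> existential_formulas n"
    using \<psi>(1) insert.prems by (auto simp: existential_formulas_def intro: existential.intros)
  then show ?case by (rule bexI[rotated]) (simp add: \<psi>(2))
qed

definition existentially_below :: "nat \<Rightarrow> (nat \<Rightarrow> 'v) \<Rightarrow> (nat \<Rightarrow> 'v) \<Rightarrow> bool" where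
  "existentially_below n e e' \<longleftrightarrow> (\<forall>\<psi>\<in>existential_formulas n. sat A e \<psi> \<longrightarrow> sat A e' \<psi>)"

lemma existentially_below_cong:
  assumes "existentially_below n e e'" "\<And>i. i < n \<Longrightarrow> e i = d i" "\<And>i. i < n \<Longrightarrow> e' i = d' i"
  shows "existentially_below n d d'"
  unfolding existentially_below_def
proof (intro ballI impI)
  fix \<psi> assume \<psi>: "\<psi> \<in> existential_formulas n" and sat: "sat A d \<psi>"
  have fv: "free_vars \<psi> \<subseteq> {..<n}" using \<psi> by (simp add: existential_formulas_def)
  have "sat A e \<psi>" using sat by (rule sat_cong[THEN iffD1, rotated]) (use fv assms(2) in auto)
  then have "sat A e' \<psi>" using assms(1) \<psi> by (simp add: existentially_below_def)
  then show "sat A d' \<psi>" by (rule sat_cong[THEN iffD1, rotated]) (use fv assms(3) in auto)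
qed

text \<open>
  If every \<open>w\<close> were excluded by some existential formula, finitely many of these formulas would
  exclude all \<open>w\<close>, because \<open>w\<close> matters only through one of finitely many types. Their
  conjunction, preceded by a quantifier, would separate \<open>e\<close> from \<open>e'\<close>.
\<close>
lemma existentially_below_extend:
  assumes below: "existentially_below n e e'" and e': "e' \<in> UNIV \<rightarrow> V" and v: "v \<in> V"
  shows "\<exists>w\<in>V. existentially_below (Suc n) (e(n := v)) (e'(n := w))"
proof (rule ccontr)
  assume "\<not> ?thesis"
  then have "\<forall>w\<in>V. \<exists>\<psi>\<in>existential_formulas (Suc n). sat A (e(n := v)) \<psi> \<and> \<not> sat A (e'(n := w)) \<psi>"
    by (auto simp: existentially_below_def)
  then obtain \<psi> where \<psi>: "\<And>w. w \<in> V \<Longrightarrow> \<psi> w \<in> existential_formulas (Suc n)"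
    "\<And>w. w \<in> V \<Longrightarrow> sat A (e(n := v)) (\<psi> w)" "\<And>w. w \<in> V \<Longrightarrow> \<not> sat A (e'(n := w)) (\<psi> w)"
    by metis
  have upd: "e'(n := w) \<in> UNIV \<rightarrow> V" if "w \<in> V" for w using e' that by auto
  obtain R where R: "finite R" "R \<subseteq> (\<lambda>w. e'(n := w)) ` V"
    "\<And>d. d \<in> (\<lambda>w. e'(n := w)) ` V \<Longrightarrow> \<exists>d'\<in>R. graph_type (Suc n) d = graph_type (Suc n) d'"
    using finite_representatives[of "(\<lambda>w. e'(n := w)) ` V" "Suc n"] upd by blast
  obtain W where W: "W \<subseteq> V" "finite W" "R = (\<lambda>w. e'(n := w)) ` W"
    using finite_subset_image[OF R(1,2)] by blast
  obtain \<chi> where \<chi>: "\<chi> \<in> existential_formulas (Suc n)" "\<And>d. sat A d \<chi> \<longleftrightarrow> (\<forall>\<theta>\<in>\<psi> ` W. sat A d \<theta>)"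
    using finite_conjunction[of "\<psi> ` W" "Suc n"] W \<psi>(1) by blast
  have "sat A (e(n := v)) \<chi>" using \<psi>(2) W by (auto simp: \<chi>(2))
  then have "sat A e (Exists n \<chi>)" using v carrier_A by auto
  moreover have "Exists n \<chi> \<in> existential_formulas n"
    using \<chi>(1) by (auto simp: existential_formulas_def less_Suc_eq intro: existential.intros)
  ultimately have "sat A e' (Exists n \<chi>)" using below unfolding existentially_below_def by blast
  then obtain w where w: "w \<in> V" "sat A (e'(n := w)) \<chi>" using carrier_A by auto
  obtain w' where w': "w' \<in> W" "graph_type (Suc n) (e'(n := w)) = graph_type (Suc n) (e'(n := w'))"
    using R(3)[of "e'(n := w)"] w(1) W(3) by auto
  have w'V: "w' \<in> V" using w'(1) W(1) by blast
  have "sat A (e'(n := w)) (\<psi> w')" using w w' by (auto simp: \<chi>(2))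
  moreover have "wf_form \<Sigma> (\<psi> w')" "free_vars (\<psi> w') \<subseteq> {..<Suc n}"
    using \<psi>(1)[OF w'V] by (auto simp: existential_formulas_def)
  ultimately have "sat A (e'(n := w')) (\<psi> w')"
    using sat_graph_type[OF _ _ upd[OF w(1)] upd[OF w'V] w'(2)] by blast
  then show False using \<psi>(3)[OF w'V] by simp
qed

text \<open>
  Enumerate \<open>V\<close> and extend the tuple \<open>e'\<close> by images of one element of \<open>V\<close> after the other. As
  atoms and their negations are existential formulas, the limit is a self-embedding.
\<close>
lemma self_embedding_extending:
  assumes below: "existentially_below n e e'" and e: "e \<in> UNIV \<rightarrow> V" and e': "e' \<in> UNIV \<rightarrow> V"
  shows "\<exists>f. self_embedding f \<and> (\<forall>i<n. f (e i) = e' i)"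
proof -
  have V: "countable V" "V \<noteq> {}" using random by (auto simp: random_graph_def)
  (* the tuple \<open>e\<close> continued by an enumeration of the whole carrier *)
  define b where "b i = (if i < n then e i else from_nat_into V (i - n))" for i
  have bV: "b i \<in> V" for i using e from_nat_into[OF V(2)] by (auto simp: b_def Pi_iff)
  have b_surj: "\<exists>i. b i = v" if v: "v \<in> V" for v
  proof -
    obtain j where "from_nat_into V j = v" using from_nat_into_surj[OF V(1) v] by blast
    then have "b (n + j) = v" by (simp add: b_def)
    then show ?thesis ..
  qed
  define P where "P m s \<longleftrightarrow> s \<in> UNIV \<rightarrow> V \<and> (\<forall>i<n. s i = e' i) \<and> existentially_below (n + m) b s" for m s
  have "\<exists>s. \<forall>m. P m (s m) \<and> (\<exists>w. s (Suc m) = (s m)(n + m := w))"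
  proof (rule dependent_nat_choice)
    have "existentially_below n b e'"
      by (rule existentially_below_cong[OF below]) (simp_all add: b_def)
    then show "\<exists>s. P 0 s" using e' by (auto simp: P_def)
  next
    fix s m assume s: "P m s"
    then obtain w where w: "w \<in> V" "existentially_below (Suc (n + m)) (b(n + m := b (n + m))) (s(n + m := w))"
      using existentially_below_extend[of "n + m" b s "b (n + m)"] bV by (auto simp: P_def)
    then have "P (Suc m) (s(n + m := w))"
      using s by (auto simp: P_def)
    then show "\<exists>s'. P (Suc m) s' \<and> (\<exists>w. s' = s(n + m := w))" by blast
  qed
  then obtain s where s: "\<And>m. P m (s m)" "\<And>m. \<exists>w. s (Suc m) = (s m)(n + m := w)" by blast
  have step: "s (Suc m) i = s m i" if "i < n + m" for m i
    using s(2)[of m] that by auto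
  have stable: "s (m + l) i = s m i" if "i < n + m" for m l i
    by (induction l) (use step that in auto)
  define g where "g i = s (Suc i) i" for i
  have g: "s m i = g i" if "i < n + m" for m i
  proof (cases "m \<le> Suc i")
    case True
    then show ?thesis using stable[OF that, of "Suc i - m"] by (simp add: g_def)
  next
    case False
    then show ?thesis using stable[of i "Suc i" "m - Suc i"] by (simp add: g_def)
  qed
  have gV: "g i \<in> V" for i using s(1) by (auto simp: g_def P_def)
  have transfer: "sat A g \<psi>" if \<psi>: "existential \<psi>" "wf_form \<Sigma> \<psi>" "sat A b \<psi>" for \<psi>
  proof -
    obtain m where "free_vars \<psi> \<subseteq> {..<m}"
      using finite_free_vars finite_nat_iff_bounded by blast
    then have "\<psi> \<in> existential_formulas (n + m)" using \<psi> by (force simp: existential_formulas_def)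
    moreover have "existentially_below (n + m) b g"
      by (rule existentially_below_cong[of _ b "s m"]) (use s(1)[of m] g in \<open>auto simp: P_def\<close>)
    ultimately show ?thesis using \<psi>(3) by (simp add: existentially_below_def)
  qed
  have eq: "b i = b j \<longleftrightarrow> g i = g j" for i j
    using transfer[of "Equal i j"] transfer[of "Neg (Equal i j)"] by (auto intro: existential.intros)
  have rel: "map b is \<in> interp A r \<longleftrightarrow> map g is \<in> interp A r" if "\<Sigma> r = Some (length is)" for r "is"
    using transfer[of "Rel r is"] transfer[of "Neg (Rel r is)"] that by (auto intro: existential.intros)
  define f where "f v = g (SOME i. b i = v)" for v
  have f: "f (b i) = g i" for i
    using someI[of "\<lambda>j. b j = b i" i] eq by (auto simp: f_def)
  have "self_embedding f"
    unfolding self_embedding_def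
  proof (intro conjI allI impI)
    show "f ` V \<subseteq> V" using b_surj f gV by (metis image_subsetI)
    show "inj_on f V" using b_surj f eq by (metis inj_onI)
    fix r xs assume r: "\<Sigma> r = Some (length xs)" and xs: "set xs \<subseteq> V"
    define idx where "idx v = (SOME i. b i = v)" for v
    have idx: "b (idx v) = v" if "v \<in> V" for v using someI_ex[OF b_surj[OF that]] by (simp add: idx_def)
    have "map b (map idx xs) = xs" using xs idx by (simp add: map_idI subset_iff)
    moreover have "map g (map idx xs) = map f xs" by (simp add: f_def idx_def)
    ultimately show "xs \<in> interp A r \<longleftrightarrow> map f xs \<in> interp A r"
      using rel[of r "map idx xs"] r by (simp only: length_map)
  qed
  moreover have "f (e i) = e' i" if "i < n" for i
  proof -
    have "f (e i) = g i" using f[of i] that by (simp add: b_def)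
    also have "\<dots> = s 0 i" using g[of i 0] that by simp
    also have "\<dots> = e' i" using s(1)[of 0] that by (simp add: P_def)
    finally show ?thesis .
  qed
  ultimately show ?thesis by blast
qed

lemma existentially_below_sat:
  assumes "existentially_below n e e'" and e: "e \<in> UNIV \<rightarrow> V" "e' \<in> UNIV \<rightarrow> V"
    and \<phi>: "wf_form \<Sigma> \<phi>" "free_vars \<phi> \<subseteq> {..<n}"
  shows "sat A e \<phi> \<longleftrightarrow> sat A e' \<phi>"
proof -
  obtain f where f: "self_embedding f" "\<And>i. i < n \<Longrightarrow> f (e i) = e' i"
    using self_embedding_extending[OF assms(1-3)] by blast
  have "sat A e \<phi> \<longleftrightarrow> sat A (f \<circ> e) \<phi>"
  proof (rule sat_env_symmetry[OF \<phi>])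
    fix T assume "T \<subseteq> {..<n}" "inj_on e T"
    then show "\<exists>d\<in>symmetries. twist d T e (f \<circ> e)"
      using e by (intro self_embedding_twist[OF f(1)]) (auto intro: finite_subset)
  qed simp
  also have "\<dots> \<longleftrightarrow> sat A e' \<phi>"
    by (rule sat_cong) (use f(2) \<phi>(2) in auto)
  finally show ?thesis .
qed

text \<open>
  Any type \<open>p\<close> that satisfies \<open>\<phi>\<close> is separated from any type \<open>q\<close> that does not by an existential
  formula that is true at \<open>p\<close> and false at \<open>q\<close>. There are finitely many types, so the disjunction over
  all \<open>p\<close> of the conjunctions over all \<open>q\<close> of these formulas is equivalent to \<open>\<phi>\<close>.
\<close>
theorem equivalent_existential_formula:
  assumes \<phi>: "wf_form \<Sigma> \<phi>" "free_vars \<phi> \<subseteq> {..<n}" and n: "n > 0"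
  shows "\<exists>\<psi>\<in>existential_formulas n. \<forall>e\<in>UNIV \<rightarrow> V. sat A e \<phi> \<longleftrightarrow> sat A e \<psi>"
proof -
  obtain R where R: "finite R" "R \<subseteq> UNIV \<rightarrow> V"
    "\<And>e. e \<in> UNIV \<rightarrow> V \<Longrightarrow> \<exists>e'\<in>R. graph_type n e = graph_type n e'"
    using finite_representatives[OF subset_refl] by blast
  define Pos where "Pos = {p\<in>R. sat A p \<phi>}"
  define Ngt where "Ngt = {q\<in>R. \<not> sat A q \<phi>}"
  have "\<exists>\<chi>\<in>existential_formulas n. sat A p \<chi> \<and> \<not> sat A q \<chi>" if "p \<in> Pos" "q \<in> Ngt" for p q
  proof -
    have "\<not> existentially_below n p q"
      using existentially_below_sat[of n p q, OF _ _ _ \<phi>] that R(2) by (auto simp: Pos_def Ngt_def)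
    then show ?thesis by (auto simp: existentially_below_def)
  qed
  then obtain \<chi> where \<chi>: "\<And>p q. p \<in> Pos \<Longrightarrow> q \<in> Ngt \<Longrightarrow> \<chi> p q \<in> existential_formulas n"
    "\<And>p q. p \<in> Pos \<Longrightarrow> q \<in> Ngt \<Longrightarrow> sat A p (\<chi> p q)" "\<And>p q. p \<in> Pos \<Longrightarrow> q \<in> Ngt \<Longrightarrow> \<not> sat A q (\<chi> p q)"
    by metis
  have fin: "finite Pos" "finite Ngt" using R(1) by (auto simp: Pos_def Ngt_def)
  have "\<exists>\<theta>\<in>existential_formulas n. \<forall>e. sat A e \<theta> \<longleftrightarrow> (\<forall>\<chi>\<in>\<chi> p ` Ngt. sat A e \<chi>)" if "p \<in> Pos" for p
    using that fin n \<chi>(1) by (intro finite_conjunction) auto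
  then obtain \<theta> where \<theta>: "\<And>p. p \<in> Pos \<Longrightarrow> \<theta> p \<in> existential_formulas n"
    "\<And>p e. p \<in> Pos \<Longrightarrow> sat A e (\<theta> p) \<longleftrightarrow> (\<forall>\<chi>\<in>\<chi> p ` Ngt. sat A e \<chi>)"
    by metis
  have "\<exists>\<psi>\<in>existential_formulas n. \<forall>e. sat A e \<psi> \<longleftrightarrow> (\<exists>\<chi>\<in>\<theta> ` Pos. sat A e \<chi>)"
    using fin n \<theta>(1) by (intro finite_disjunction) auto
  then obtain \<psi> where \<psi>: "\<psi> \<in> existential_formulas n" "\<And>e. sat A e \<psi> \<longleftrightarrow> (\<exists>p\<in>Pos. sat A e (\<theta> p))"
    by auto
  have \<psi>_wf: "wf_form \<Sigma> \<psi>" "free_vars \<psi> \<subseteq> {..<n}" using \<psi>(1) by (auto simp: existential_formulas_def)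
  have on_R: "sat A p \<phi> \<longleftrightarrow> sat A p \<psi>" if p: "p \<in> R" for p
  proof
    assume "sat A p \<phi>"
    then have Pos: "p \<in> Pos" using p by (simp add: Pos_def)
    have "sat A p (\<theta> p)" unfolding \<theta>(2)[OF Pos] using \<chi>(2)[OF Pos] by simp
    then show "sat A p \<psi>" unfolding \<psi>(2) using Pos by (rule bexI)
  next
    assume "sat A p \<psi>"
    then obtain q where q: "q \<in> Pos" "sat A p (\<theta> q)" unfolding \<psi>(2) ..
    have "p \<notin> Ngt" using q(2) \<chi>(3)[OF q(1)] unfolding \<theta>(2)[OF q(1)] by auto
    then show "sat A p \<phi>" using p by (simp add: Ngt_def)
  qed
  have "sat A e \<phi> \<longleftrightarrow> sat A e \<psi>" if e: "e \<in> UNIV \<rightarrow> V" for e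
  proof -
    obtain p where p: "p \<in> R" "graph_type n e = graph_type n p" using R(3) e by blast
    have pV: "p \<in> UNIV \<rightarrow> V" using p R(2) by blast
    show ?thesis
      using sat_graph_type[OF \<phi> e pV p(2)] sat_graph_type[OF \<psi>_wf e pV p(2)] on_R[OF p(1)] by simp
  qed
  then show ?thesis using \<psi>(1) by blast
qed

end

section \<open>Model-completeness\<close>

text \<open>
  Theories consist of sentences, so the equivalence of two formulas is transferred between models by
  means of its universal closure.
\<close>

primrec universal_closure :: "nat \<Rightarrow> 's form \<Rightarrow> 's form" where
  "universal_closure 0 \<theta> = \<theta>"
| "universal_closure (Suc n) \<theta> = universal_closure n (Neg (Exists n (Neg \<theta>)))"

lemma wf_universal_closure [simp]: "wf_form \<Sigma> (universal_closure n \<theta>) \<longleftrightarrow> wf_form \<Sigma> \<theta>"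
  by (induction n arbitrary: \<theta>) auto

lemma free_vars_universal_closure [simp]: "free_vars (universal_closure n \<theta>) = free_vars \<theta> - {..<n}"
  by (induction n arbitrary: \<theta>) (auto simp: less_Suc_eq)

lemma valid_in_Forall: "valid_in M (Neg (Exists n (Neg \<theta>))) \<longleftrightarrow> valid_in M \<theta>"
proof
  assume valid: "valid_in M (Neg (Exists n (Neg \<theta>)))"
  show "valid_in M \<theta>"
    unfolding valid_in_def
  proof
    fix e assume e: "e \<in> (UNIV :: nat set) \<rightarrow> carrier M"
    then have "sat M (e(n := e n)) \<theta>" using valid by (auto simp: valid_in_def simp del: fun_upd_triv)
    then show "sat M e \<theta>" by simp
  qed
next
  assume valid: "valid_in M \<theta>"
  have "sat M (e(n := a)) \<theta>" if "e \<in> UNIV \<rightarrow> carrier M" "a \<in> carrier M" for e a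
  proof -
    have "e(n := a) \<in> UNIV \<rightarrow> carrier M" using that by auto
    then show ?thesis using valid by (simp add: valid_in_def)
  qed
  then show "valid_in M (Neg (Exists n (Neg \<theta>)))" by (simp add: valid_in_def)
qed

lemma valid_in_universal_closure: "valid_in M (universal_closure n \<theta>) \<longleftrightarrow> valid_in M \<theta>"
  by (induction n arbitrary: \<theta>) (simp_all add: valid_in_Forall del: sat.simps)

theorem corollary14:
  fixes V :: "'v set" and E :: "('v \<times> 'v) set"
    and \<Sigma> :: "'s signature" and A :: "('s, 'v) rel_structure"
  assumes "random_graph V E"
    and "is_reduct \<Sigma> A graph_signature (graph_structure V E)"
  shows "model_complete TYPE('m) TYPE('n) \<Sigma> A"
  unfolding model_complete_def model_complete_theory_def
proof (intro allI impI)
  fix M :: "('s, 'm) rel_structure" and N :: "('s, 'n) rel_structure" and h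
  assume MN: "is_model \<Sigma> (theory_of \<Sigma> A) M \<and> is_model \<Sigma> (theory_of \<Sigma> A) N \<and> embedding \<Sigma> M N h"
  interpret random_graph_reduct V E \<Sigma> A
    by unfold_locales (use assms in simp_all)
  show "elementary \<Sigma> M N h"
    unfolding elementary_def
  proof (intro allI impI ballI)
    fix \<phi> :: "'s form" and e
    assume \<phi>: "wf_form \<Sigma> \<phi>" and e: "e \<in> UNIV \<rightarrow> carrier M" and sat: "sat M e \<phi>"
    obtain m where "free_vars \<phi> \<subseteq> {..<m}" using finite_free_vars finite_nat_iff_bounded by blast
    then have fv: "free_vars \<phi> \<subseteq> {..<Suc m}" by auto
    obtain \<psi> where \<psi>: "\<psi> \<in> existential_formulas (Suc m)"
      "\<And>e. e \<in> UNIV \<rightarrow> V \<Longrightarrow> sat A e \<phi> \<longleftrightarrow> sat A e \<psi>"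
      using equivalent_existential_formula[OF \<phi> fv] by blast
    have \<psi>': "existential \<psi>" "wf_form \<Sigma> \<psi>" "free_vars \<psi> \<subseteq> {..<Suc m}"
      using \<psi>(1) by (auto simp: existential_formulas_def)
    define \<theta> where "\<theta> = Conj (Neg (Conj \<phi> (Neg \<psi>))) (Neg (Conj \<psi> (Neg \<phi>)))"
    have "valid_in A \<theta>" using \<psi>(2) by (auto simp: valid_in_def \<theta>_def carrier_A)
    then have "universal_closure (Suc m) \<theta> \<in> theory_of \<Sigma> A"
      using \<phi> \<psi>' fv by (auto simp: theory_of_def sentences_def valid_in_universal_closure \<theta>_def
          simp del: universal_closure.simps)
    then have "valid_in M \<theta>" "valid_in N \<theta>"
      using MN valid_in_universal_closure unfolding is_model_def by blast+
    then have M: "sat M e \<phi> \<longleftrightarrow> sat M e \<psi>"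
      and N: "\<And>e. e \<in> UNIV \<rightarrow> carrier N \<Longrightarrow> sat N e \<phi> \<longleftrightarrow> sat N e \<psi>"
      using e by (auto simp: valid_in_def \<theta>_def)
    have "sat N (h \<circ> e) \<psi>"
      using MN \<psi>' e sat M by (intro existential_preserved[of \<Sigma> M N h]) auto
    moreover have "h \<circ> e \<in> UNIV \<rightarrow> carrier N" using MN e by (auto simp: embedding_def)
    ultimately show "sat N (h \<circ> e) \<phi>" using N by blast
  qed
qed

end
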